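(* Let $V$ be an infinite-dimensional left vector space over a division ring, and let $\mathrm{GL}(V)$ be the group of all invertible linear transformations from $V$ to itself. Let $X$ be any generating set of the group $\mathrm{GL}(V)$. Then the width of $\mathrm{GL}(V)$ with respect to $X$ is finite.
   Context: Let $G$ be a group and $S$ a generating set of $G$. For $x \in G$, the length $|x|_S$ of $x$ relative to $S$ is the minimal natural number $k$ such that $x$ is a product of $k$ elements of $S \cup S^{-1}$. The width $\mathrm{wid}(G,S)$ of $G$ relative to $S$ is the supremum of all $|x|_S$ for $x \in G$; it is either a natural number or $\infty$. The dimension of $V$ is an arbitrary infinite cardinal and the division ring is arbitrary. *)

theory Defs
  imports "HOL-Algebra.Generated_Groups" "HOL-Library.Extended_Nat"
begin

(* The locales module and vector_space of HOL.Modules and HOL.Vector_Spaces require commutative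
   scalars.  The definitions below follow them over an arbitrary division ring. *)

locale left_vector_space =
  fixes scale :: "'k::division_ring \<Rightarrow> 'v::ab_group_add \<Rightarrow> 'v" (infixr "*s" 75)
  assumes scale_right_distrib: "a *s (x + y) = a *s x + a *s y"
    and scale_left_distrib: "(a + b) *s x = a *s x + b *s x"
    and scale_scale: "a *s (b *s x) = (a * b) *s x"
    and scale_one: "1 *s x = x"
begin

definition span :: "'v set \<Rightarrow> 'v set" where
  "span B = {(\<Sum>v\<in>T. u v *s v) | T u. finite T \<and> T \<subseteq> B}"

definition independent :: "'v set \<Rightarrow> bool" where
  "independent B \<longleftrightarrow>
     (\<forall>T u. finite T \<and> T \<subseteq> B \<and> (\<Sum>v\<in>T. u v *s v) = 0 \<longrightarrow> (\<forall>v\<in>T. u v = 0))"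

definition is_basis :: "'v set \<Rightarrow> bool" where
  "is_basis B \<longleftrightarrow> independent B \<and> span B = UNIV"

definition infinite_dimensional :: bool where
  "infinite_dimensional \<longleftrightarrow> \<not> (\<exists>B. finite B \<and> is_basis B)"

definition linear_map :: "('v \<Rightarrow> 'v) \<Rightarrow> bool" where
  "linear_map f \<longleftrightarrow> (\<forall>x y. f (x + y) = f x + f y) \<and> (\<forall>a x. f (a *s x) = a *s f x)"

definition GL :: "('v \<Rightarrow> 'v) monoid" where
  "GL = \<lparr>carrier = {f. linear_map f \<and> bij f}, mult = (\<circ>), one = id\<rparr>"

lemma linear_map_inv:
  assumes "linear_map f" "bij f"
  shows "linear_map (inv_into UNIV f)"
proof -
  have *: "f (inv_into UNIV f x) = x" for x
    using assms(2) by (simp add: bij_is_surj surj_f_inv_f)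
  have **: "inv_into UNIV f (f x) = x" for x
    using assms(2) by (simp add: bij_is_inj)
  have "inv_into UNIV f (x + y) = inv_into UNIV f x + inv_into UNIV f y" for x y
    using assms(1) **[of "inv_into UNIV f x + inv_into UNIV f y"] by (simp add: linear_map_def *)
  moreover have "inv_into UNIV f (a *s x) = a *s inv_into UNIV f x" for a x
    using assms(1) **[of "a *s inv_into UNIV f x"] by (simp add: linear_map_def *)
  ultimately show ?thesis
    by (simp add: linear_map_def)
qed

lemma group_GL: "group GL"
proof (rule groupI)
  fix f assume f: "f \<in> carrier GL"
  then have "inv_into UNIV f \<in> carrier GL"
    by (simp add: GL_def linear_map_inv bij_imp_bij_inv)
  moreover have "inv_into UNIV f \<otimes>\<^bsub>GL\<^esub> f = \<one>\<^bsub>GL\<^esub>"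
    using f by (simp add: GL_def bij_is_inj)
  ultimately show "\<exists>g\<in>carrier GL. g \<otimes>\<^bsub>GL\<^esub> f = \<one>\<^bsub>GL\<^esub>"
    by blast
qed (auto simp: GL_def linear_map_def bij_comp comp_assoc)

end

definition is_product_of :: "('a, 'b) monoid_scheme \<Rightarrow> 'a set \<Rightarrow> nat \<Rightarrow> 'a \<Rightarrow> bool" where
  "is_product_of G S k x \<longleftrightarrow>
     (\<exists>xs. length xs = k \<and> set xs \<subseteq> S \<union> m_inv G ` S \<and> x = foldr (mult G) xs (one G))"

(* Only meaningful for x in the subgroup generated by S. *)
definition word_length :: "('a, 'b) monoid_scheme \<Rightarrow> 'a set \<Rightarrow> 'a \<Rightarrow> nat" where
  "word_length G S x = (LEAST k. is_product_of G S k x)"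

definition wid :: "('a, 'b) monoid_scheme \<Rightarrow> 'a set \<Rightarrow> enat" where
  "wid G S = (SUP x\<in>carrier G. enat (word_length G S x))"

definition generating_set :: "('a, 'b) monoid_scheme \<Rightarrow> 'a set \<Rightarrow> bool" where
  "generating_set G S \<longleftrightarrow> S \<subseteq> carrier G \<and> generate G S = carrier G"

end

theory Submission
  imports Defs "HOL-Library.Equipollence"
begin

text \<open>Word length is a subadditive, inversion-invariant function on \<open>GL\<close>; every such function is
  bounded. Write \<open>V\<close> as a countable sum of copies of itself. Bergman's diagonal argument gives one
  row of copies on which all diagonal families extend, with uncontrolled entries elsewhere, to
  elements of bounded length. A commutator with the shift of that row removes the uncontrolled entries and
  leaves an arbitrary element on a single copy, so \<open>GL(U) \<times> 1\<close> is bounded whenever \<open>U\<close> and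
  its complement both have full dimension. Finally, for \<open>V = A \<oplus> C1 \<oplus> C2\<close> with
  summands of full dimension, every \<open>f\<close> is a product of boundedly many elements of such
  groups and one fixed map: \<open>f(A)\<close> is moved back to \<open>A\<close> by first straightening it into
  \<open>K0 \<oplus> L0\<close> with \<open>K0 \<subseteq> A\<close> and \<open>L0 \<subseteq> C1 \<oplus> C2\<close>, one of which has full
  codimension.\<close>

section \<open>Word length\<close>

text \<open>Three obstacles shape the proof. The swindle only bounds groups that act trivially on a
  complement of full dimension. A map \<open>1 + \<nu>\<close> with \<open>\<nu>\<close> from
  \<open>span C\<close> to \<open>span A\<close> may move all of \<open>C\<close>; halving
  \<open>C\<close> splits it into two factors, each of which fixes one half. Second, f(A) may lie
  askew: it need not be the sum of a part of \<open>span A\<close> and a part of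
  \<open>span C\<close>. A transvection repairs this. Third, dimensions are arbitrary infinite
  cardinals. All that is known about the straightened subspace is that \<open>K1 \<union> L1\<close>
  spans a complement of full dimension. An infinite set is not a union of two smaller ones, so
  \<open>K1\<close> or \<open>L1\<close> is large. The large one has to lie in
  \<open>span C\<close>, to leave room for block maps; if it is \<open>K1\<close>, the fixed map
  exchanging \<open>span A\<close> and \<open>span C\<close> puts it there. The bound is uniform
  because the maps whose own lengths enter it (shift, conjugating map, exchange) are chosen before
  f, while every factor depending on f lies in a set already known to be bounded.\<close>

context group
begin

lemma is_product_of_mult:
  assumes S: "S \<subseteq> carrier G" and x: "is_product_of G S k x" and y: "is_product_of G S l y"
  shows "is_product_of G S (k + l) (x \<otimes> y)"
proof -
  obtain xs ys where *: "length xs = k" "set xs \<subseteq> S \<union> m_inv G ` S" "x = foldr (\<otimes>) xs \<one>"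
    "length ys = l" "set ys \<subseteq> S \<union> m_inv G ` S" "y = foldr (\<otimes>) ys \<one>"
    using x y unfolding is_product_of_def by blast
  have sub: "S \<union> m_inv G ` S \<subseteq> carrier G" using S by auto
  have closed: "foldr (\<otimes>) zs \<one> \<in> carrier G" if "set zs \<subseteq> carrier G" for zs
    using that by (induction zs) auto
  have "foldr (\<otimes>) (xs @ zs) \<one> = foldr (\<otimes>) xs \<one> \<otimes> foldr (\<otimes>) zs \<one>"
    if "set xs \<subseteq> carrier G" "set zs \<subseteq> carrier G" for xs zs
    using that(1) by (induction xs) (auto simp: closed that(2) m_assoc)
  moreover have "set xs \<subseteq> carrier G" "set ys \<subseteq> carrier G" using *(2,5) sub by blast+
  ultimately have "foldr (\<otimes>) (xs @ ys) \<one> = x \<otimes> y" unfolding *(3,6) by blast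
  then show ?thesis
    unfolding is_product_of_def using * by (intro exI[of _ "xs @ ys"]) auto
qed

lemma is_product_of_gen:
  assumes "S \<subseteq> carrier G" "s \<in> S \<union> m_inv G ` S"
  shows "is_product_of G S 1 s"
  unfolding is_product_of_def using assms by (intro exI[of _ "[s]"]) auto

text \<open>Inverting a word reverses it and inverts its letters; the alphabet is closed under
  inversion, so the number of letters stays the same. The induction carries membership in the
  carrier along because \<open>inv_mult_group\<close> needs it.\<close>

lemma is_product_of_inv:
  assumes S: "S \<subseteq> carrier G" and x: "is_product_of G S k x"
  shows "is_product_of G S k (inv x)"
proof -
  have "is_product_of G S (length xs) (inv (foldr (\<otimes>) xs \<one>)) \<and> foldr (\<otimes>) xs \<one> \<in> carrier G"
    if "set xs \<subseteq> S \<union> m_inv G ` S" for xs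
    using that
  proof (induction xs)
    case Nil
    then show ?case by (simp add: is_product_of_def)
  next
    case (Cons a xs)
    then have a: "a \<in> S \<union> m_inv G ` S" "a \<in> carrier G" using S by auto
    then have "inv a \<in> S \<union> m_inv G ` S" using S by auto
    then have "is_product_of G S (length xs + 1) (inv (foldr (\<otimes>) xs \<one>) \<otimes> inv a)"
      using Cons by (intro is_product_of_mult[OF S] is_product_of_gen[OF S]) auto
    then show ?case using Cons a by (simp add: inv_mult_group)
  qed
  then show ?thesis using x unfolding is_product_of_def by blast
qed

text \<open>Ensures that the \<open>LEAST\<close> in \<open>word_length\<close> is attained on the
  generated subgroup.\<close>

lemma is_product_of_exists:
  assumes S: "S \<subseteq> carrier G" and "x \<in> generate G S"
  shows "\<exists>k. is_product_of G S k x"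
  using assms(2)
proof (induction rule: generate.induct)
  case one
  show ?case by (auto simp: is_product_of_def intro: exI[of _ "[]"])
next
  case (incl h)
  then show ?case using is_product_of_gen[OF S] by blast
next
  case (inv h)
  then show ?case using is_product_of_gen[OF S] by blast
next
  case (eng h1 h2)
  then show ?case using is_product_of_mult[OF S] by blast
qed

context
  fixes S
  assumes S: "generating_set G S"
begin

lemma is_product_of_word_length: "x \<in> carrier G \<Longrightarrow> is_product_of G S (word_length G S x) x"
  using is_product_of_exists S unfolding word_length_def generating_set_def by (metis LeastI)

lemma word_length_mult:
  "x \<in> carrier G \<Longrightarrow> y \<in> carrier G \<Longrightarrow> word_length G S (x \<otimes> y) \<le> word_length G S x + word_length G S y"
  using is_product_of_mult is_product_of_word_length S unfolding word_length_def generating_set_def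
  by (metis Least_le)

lemma word_length_inv: "x \<in> carrier G \<Longrightarrow> word_length G S (inv x) \<le> word_length G S x"
  using is_product_of_inv is_product_of_word_length S unfolding word_length_def generating_set_def
  by (metis Least_le)

end

end

section \<open>Infinite cardinalities\<close>

lemma lepoll_iff_card_of_ordLeq: "A \<lesssim> B \<longleftrightarrow> (card_of A, card_of B) \<in> ordLeq"
  by (simp add: lepoll_def card_of_ordLeq)

lemma UN_finite_lepoll:
  assumes "infinite I" "\<And>i. i \<in> I \<Longrightarrow> finite (A i)"
  shows "(\<Union>i\<in>I. A i) \<lesssim> I"
  using card_of_UNION_ordLeq_infinite[OF assms(1), of I A] assms
  by (simp add: lepoll_iff_card_of_ordLeq[symmetric] finite_lepoll_infinite)

text \<open>Cardinals smaller than an infinite one have a smaller sum. This decides later which of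
  two complements is large.\<close>

lemma infinite_lepoll_Un:
  assumes "infinite C" "C \<lesssim> X \<union> Y"
  shows "C \<lesssim> X \<or> C \<lesssim> Y"
proof (rule ccontr)
  assume "\<not> ?thesis"
  then have "(card_of X, card_of C) \<in> ordLess" "(card_of Y, card_of C) \<in> ordLess"
    by (simp_all add: lepoll_iff_card_of_ordLeq not_ordLeq_iff_ordLess card_of_Well_order)
  then have "(card_of (X \<union> Y), card_of C) \<in> ordLess"
    by (rule card_of_Un_ordLess_infinite[OF assms(1)])
  then show False
    using assms(2) not_ordLess_ordLeq by (auto simp: lepoll_iff_card_of_ordLeq)
qed

lemma infinite_Un_lepoll:
  assumes "infinite C" "X \<lesssim> C" "Y \<lesssim> C"
  shows "X \<union> Y \<lesssim> C"
  using assms infinite_lepoll_Un[of "X \<union> Y" X Y]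
  by (metis finite_Un finite_lepoll_infinite lepoll_refl lepoll_trans)

text \<open>Serves with \<open>bool\<close> to halve a set and with \<open>nat \<times> int\<close>
  to cut a basis into the copies of the diagonal argument.\<close>

lemma times_countable_eqpoll:
  fixes T :: "'t::countable set"
  assumes "infinite B" "T \<noteq> {}"
  shows "B \<times> T \<approx> B"
proof -
  have "T \<lesssim> (UNIV :: nat set)"
    unfolding lepoll_def by (metis inj_on_subset inj_to_nat subset_UNIV)
  also have "(UNIV :: nat set) \<lesssim> B" using assms(1) infinite_le_lepoll by blast
  finally have "(card_of T, card_of B) \<in> ordLeq" by (simp add: lepoll_iff_card_of_ordLeq)
  then show ?thesis
    using card_of_Times_infinite[OF assms] by (simp add: eqpoll_iff_card_of_ordIso)
qed

lemma infinite_split: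
  assumes "infinite B"
  obtains X Y where "X \<union> Y = B" "X \<inter> Y = {}" "X \<approx> B" "Y \<approx> B"
proof -
  obtain f where f: "bij_betw f (B \<times> (UNIV :: bool set)) B"
    using times_countable_eqpoll[OF assms, of "UNIV :: bool set"] by (auto simp: eqpoll_def)
  have eq: "f ` (B \<times> {t}) \<approx> B" for t
  proof -
    have "inj_on f (B \<times> {t})" using f by (auto simp: bij_betw_def inj_on_def)
    then have "f ` (B \<times> {t}) \<approx> B \<times> {t}" by (rule inj_on_image_eqpoll_self)
    also have "B \<times> {t} \<approx> B" by (rule times_countable_eqpoll[OF assms]) simp
    finally show ?thesis .
  qed
  show thesis
  proof (rule that[OF _ _ eq eq])
    have "B \<times> UNIV = B \<times> {True} \<union> B \<times> {False}" by auto
    then show "f ` (B \<times> {True}) \<union> f ` (B \<times> {False}) = B"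
      using f by (simp add: bij_betw_def image_Un[symmetric])
    show "f ` (B \<times> {True}) \<inter> f ` (B \<times> {False}) = {}"
      using f by (auto simp: bij_betw_def inj_on_def)
  qed
qed

lemma infinite_eqpoll_between:
  assumes "infinite B" "X \<approx> B" "X \<subseteq> Y" "Y \<lesssim> B"
  shows "Y \<approx> B"
  using assms by (meson eqpoll_sym lepoll_antisym lepoll_trans1 subset_imp_lepoll)

text \<open>\<open>GL_from_bij\<close> takes one bijection between whole bases; its two restrictions
  record which block goes where.\<close>

lemma bij_betw_Un_obtain:
  assumes "X \<approx> X'" "Y \<approx> Y'" "X \<inter> Y = {}" "X' \<inter> Y' = {}"
  obtains q where "bij_betw q X X'" "bij_betw q Y Y'" "bij_betw q (X \<union> Y) (X' \<union> Y')"
proof -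
  obtain f g where fg: "bij_betw f X X'" "bij_betw g Y Y'" using assms(1,2) by (auto simp: eqpoll_def)
  let ?q = "\<lambda>x. if x \<in> X then f x else g x"
  have "bij_betw ?q X X'" using fg(1) by (subst bij_betw_cong[of X ?q f]) auto
  moreover have "bij_betw ?q Y Y'"
    using fg(2) assms(3) by (subst bij_betw_cong[of Y ?q g]) auto
  ultimately show thesis using that bij_betw_combine assms(4) by blast
qed

section \<open>Linear algebra over a division ring\<close>

abbreviation inverse_map :: "('a \<Rightarrow> 'b) \<Rightarrow> 'b \<Rightarrow> 'a" where
  "inverse_map f \<equiv> inv_into UNIV f"

context left_vector_space
begin

lemma scale_zero_right [simp]: "a *s 0 = 0"
  using scale_right_distrib[of a 0 0] by simp

lemma scale_zero_left [simp]: "0 *s x = 0"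
  using scale_left_distrib[of 0 0 x] by simp

lemma scale_minus_left: "(- a) *s x = - (a *s x)"
  using scale_left_distrib[of a "- a" x] by (simp add: eq_neg_iff_add_eq_0 add.commute)

lemma scale_minus_right: "a *s (- x) = - (a *s x)"
  using scale_right_distrib[of a x "- x"] by (simp add: eq_neg_iff_add_eq_0 add.commute)

lemma scale_sum_right: "a *s sum f T = (\<Sum>x\<in>T. a *s f x)"
  by (induction T rule: infinite_finite_induct) (simp_all add: scale_right_distrib)

text \<open>The coefficients \<open>w\<close> do not depend on \<open>f\<close>: the same ones serve
  for the vectors and for their prescribed images, which makes the relation in
  \<open>linear_extension\<close> additive.\<close>

lemma combination_add:
  assumes "finite T" "finite T'"
  obtains w where "\<And>f :: 'v \<Rightarrow> 'v.
    (\<Sum>x\<in>T. u x *s f x) + (\<Sum>x\<in>T'. u' x *s f x) = (\<Sum>x\<in>T \<union> T'. w x *s f x)"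
proof
  fix f :: "'v \<Rightarrow> 'v"
  let ?e = "\<lambda>S v x. if x \<in> S then v x else 0"
  have "(\<Sum>x\<in>T. u x *s f x) = (\<Sum>x\<in>T \<union> T'. ?e T u x *s f x)"
    by (rule sum.mono_neutral_cong_left) (use assms in auto)
  moreover have "(\<Sum>x\<in>T'. u' x *s f x) = (\<Sum>x\<in>T \<union> T'. ?e T' u' x *s f x)"
    by (rule sum.mono_neutral_cong_left) (use assms in auto)
  ultimately show "(\<Sum>x\<in>T. u x *s f x) + (\<Sum>x\<in>T'. u' x *s f x)
      = (\<Sum>x\<in>T \<union> T'. (?e T u x + ?e T' u' x) *s f x)"
    by (simp add: sum.distrib[symmetric] scale_left_distrib)
qed

section \<open>Subspaces and spans\<close>

definition subspace :: "'v set \<Rightarrow> bool" where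
  "subspace W \<longleftrightarrow> 0 \<in> W \<and> (\<forall>x\<in>W. \<forall>y\<in>W. x + y \<in> W) \<and> (\<forall>a. \<forall>x\<in>W. a *s x \<in> W)"

lemma subspace_sum:
  assumes "subspace W" "\<And>x. x \<in> T \<Longrightarrow> f x \<in> W"
  shows "sum f T \<in> W"
  using assms(2) by (induction T rule: infinite_finite_induct)
    (use assms(1) in \<open>auto simp: subspace_def\<close>)

lemma subspace_uminus: "subspace W \<Longrightarrow> x \<in> W \<Longrightarrow> - x \<in> W"
  unfolding subspace_def using scale_minus_left[of 1 x] by (metis scale_one)

lemma subspace_diff: "subspace W \<Longrightarrow> x \<in> W \<Longrightarrow> y \<in> W \<Longrightarrow> x - y \<in> W"
  using subspace_uminus[of W y] unfolding subspace_def by (metis diff_conv_add_uminus)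

lemma subspace_span: "subspace (span X)"
  unfolding subspace_def
proof (intro conjI ballI allI)
  show "0 \<in> span X" unfolding span_def by (auto intro!: exI[of _ "{}"])
next
  fix x y assume "x \<in> span X" "y \<in> span X"
  then obtain T u T' u' where *: "finite T" "T \<subseteq> X" "x = (\<Sum>v\<in>T. u v *s v)"
    "finite T'" "T' \<subseteq> X" "y = (\<Sum>v\<in>T'. u' v *s v)"
    unfolding span_def by blast
  obtain w where "\<And>f :: 'v \<Rightarrow> 'v.
    (\<Sum>x\<in>T. u x *s f x) + (\<Sum>x\<in>T'. u' x *s f x) = (\<Sum>x\<in>T \<union> T'. w x *s f x)"
    using combination_add[OF *(1,4)] by blast
  from this[of "\<lambda>x. x"] * have "x + y = (\<Sum>v\<in>T \<union> T'. w v *s v)" by simp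
  moreover have "finite (T \<union> T')" "T \<union> T' \<subseteq> X" using * by auto
  ultimately show "x + y \<in> span X" unfolding span_def by blast
next
  fix a x assume "x \<in> span X"
  then obtain T u where *: "finite T" "T \<subseteq> X" "x = (\<Sum>v\<in>T. u v *s v)"
    unfolding span_def by blast
  have "a *s x = (\<Sum>v\<in>T. (a * u v) *s v)" by (simp add: *(3) scale_sum_right scale_scale)
  then show "a *s x \<in> span X" unfolding span_def mem_Collect_eq using *(1,2)
    by (intro exI[of _ T] exI[of _ "\<lambda>v. a * u v"]) simp
qed

lemma span_superset: "X \<subseteq> span X"
proof
  fix x assume "x \<in> X"
  then show "x \<in> span X"
    unfolding span_def by (auto simp: scale_one intro!: exI[of _ "{x}"] exI[of _ "\<lambda>_. 1"])
qed

lemma span_base: "x \<in> X \<Longrightarrow> x \<in> span X"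
  using span_superset by blast

lemma span_minimal:
  assumes "X \<subseteq> W" "subspace W"
  shows "span X \<subseteq> W"
proof
  fix x assume "x \<in> span X"
  then obtain T u where *: "T \<subseteq> X" "x = (\<Sum>v\<in>T. u v *s v)"
    unfolding span_def by blast
  have "u v *s v \<in> W" if "v \<in> T" for v
    using that *(1) assms unfolding subspace_def by blast
  then show "x \<in> W" unfolding *(2) by (rule subspace_sum[OF assms(2)])
qed

lemma span_mono: "X \<subseteq> Y \<Longrightarrow> span X \<subseteq> span Y"
  using span_minimal[OF _ subspace_span] span_superset by blast

lemma span_span_subset: "X \<subseteq> span Y \<Longrightarrow> span X \<subseteq> span Y"
  using span_minimal[OF _ subspace_span] .

lemma span_subspace: "subspace W \<Longrightarrow> span W = W"
  using span_minimal[of W W] span_superset by blast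

lemma span_0: "0 \<in> span X"
  and span_add: "x \<in> span X \<Longrightarrow> y \<in> span X \<Longrightarrow> x + y \<in> span X"
  and span_scale: "x \<in> span X \<Longrightarrow> a *s x \<in> span X"
  using subspace_span[of X] by (auto simp: subspace_def)

lemmas span_diff = subspace_diff[OF subspace_span]
lemmas span_uminus = subspace_uminus[OF subspace_span]
lemmas span_sum = subspace_sum[OF subspace_span]

lemma span_Un: "span (X \<union> Y) = {x + y |x y. x \<in> span X \<and> y \<in> span Y}"
proof
  have "subspace {x + y |x y. x \<in> span X \<and> y \<in> span Y}"
    unfolding subspace_def
  proof (intro conjI ballI allI)
    show "0 \<in> {x + y |x y. x \<in> span X \<and> y \<in> span Y}"
      using span_0 by (auto intro!: exI[of _ 0])
  next
    fix v w assume "v \<in> {x + y |x y. x \<in> span X \<and> y \<in> span Y}"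
      "w \<in> {x + y |x y. x \<in> span X \<and> y \<in> span Y}"
    then obtain x y x' y' where *: "v = x + y" "w = x' + y'" "x \<in> span X" "y \<in> span Y"
      "x' \<in> span X" "y' \<in> span Y" by blast
    then have "v + w = (x + x') + (y + y')" by (simp add: algebra_simps)
    then show "v + w \<in> {x + y |x y. x \<in> span X \<and> y \<in> span Y}"
      using * span_add by blast
  next
    fix a v assume "v \<in> {x + y |x y. x \<in> span X \<and> y \<in> span Y}"
    then show "a *s v \<in> {x + y |x y. x \<in> span X \<and> y \<in> span Y}"
      using span_scale scale_right_distrib by blast
  qed
  moreover have "X \<union> Y \<subseteq> {x + y |x y. x \<in> span X \<and> y \<in> span Y}"
  proof
    fix v assume "v \<in> X \<union> Y"
    then have "(v \<in> span X \<and> 0 \<in> span Y \<and> v = v + 0) \<or> (0 \<in> span X \<and> v \<in> span Y \<and> v = 0 + v)"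
      using span_base span_0 by auto
    then show "v \<in> {x + y |x y. x \<in> span X \<and> y \<in> span Y}" by blast
  qed
  ultimately show "span (X \<union> Y) \<subseteq> {x + y |x y. x \<in> span X \<and> y \<in> span Y}"
    by (rule span_minimal[rotated])
  show "{x + y |x y. x \<in> span X \<and> y \<in> span Y} \<subseteq> span (X \<union> Y)"
    using span_mono[of X "X \<union> Y"] span_mono[of Y "X \<union> Y"] span_add by blast
qed

section \<open>Linear independence\<close>

lemma independent_mono: "independent X \<Longrightarrow> Y \<subseteq> X \<Longrightarrow> independent Y"
  unfolding independent_def by blast

lemma independentD:
  "\<lbrakk>independent X; finite T; T \<subseteq> X; (\<Sum>v\<in>T. u v *s v) = 0; v \<in> T\<rbrakk> \<Longrightarrow> u v = 0"
  unfolding independent_def by blast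

lemma independent_not_span:
  assumes "independent X" "b \<in> X"
  shows "b \<notin> span (X - {b})"
proof
  assume "b \<in> span (X - {b})"
  then obtain T u where *: "finite T" "T \<subseteq> X - {b}" "b = (\<Sum>v\<in>T. u v *s v)"
    unfolding span_def by blast
  \<comment> \<open>Giving \<open>b\<close> the coefficient \<open>- 1\<close> turns its expansion
    into a nontrivial relation.\<close>
  have "(\<Sum>v\<in>insert b T. (if v = b then - 1 else u v) *s v)
      = - 1 *s b + (\<Sum>v\<in>T. (if v = b then - 1 else u v) *s v)"
    using *(1,2) by (subst sum.insert) auto
  also have "(\<Sum>v\<in>T. (if v = b then - 1 else u v) *s v) = (\<Sum>v\<in>T. u v *s v)"
    by (rule sum.cong) (use *(2) in auto)
  also have "\<dots> = b" by (rule *(3)[symmetric])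
  finally have "(\<Sum>v\<in>insert b T. (if v = b then - 1 else u v) *s v) = 0"
    by (simp add: scale_minus_left scale_one)
  then have "(if b = b then - 1 else u b) = 0"
    by (rule independentD[OF assms(1), rotated 2]) (use * assms in auto)
  then show False by simp
qed

lemma independent_insert:
  assumes "independent X" "b \<notin> span X"
  shows "independent (insert b X)"
  unfolding independent_def
proof (intro allI impI, elim conjE)
  fix T u assume T: "finite T" "T \<subseteq> insert b X" and 0: "(\<Sum>v\<in>T. u v *s v) = 0"
  have X: "T - {b} \<subseteq> X" using T by blast
  have sp: "(\<Sum>v\<in>T - {b}. u v *s v) \<in> span X"
    by (intro span_sum span_scale span_base) (use X in blast)
  \<comment> \<open>A nonzero \<open>u b\<close> can be divided out, which would put
    \<open>b\<close> into \<open>span X\<close>.\<close>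
  have ub: "u b = 0" if "b \<in> T"
  proof (rule ccontr)
    assume "u b \<noteq> 0"
    have "u b *s b + (\<Sum>v\<in>T - {b}. u v *s v) = 0"
      using 0 sum.remove[OF T(1) that, of "\<lambda>v. u v *s v"] by simp
    then have "u b *s b = - (\<Sum>v\<in>T - {b}. u v *s v)" by (simp add: eq_neg_iff_add_eq_0)
    then have "u b *s b \<in> span X" using sp span_uminus by simp
    then have "inverse (u b) *s (u b *s b) \<in> span X" by (rule span_scale)
    then show False using assms(2) \<open>u b \<noteq> 0\<close> by (simp add: scale_scale scale_one)
  qed
  have "(\<Sum>v\<in>T - {b}. u v *s v) = 0"
  proof (cases "b \<in> T")
    case True
    then show ?thesis using 0 sum.remove[OF T(1) True, of "\<lambda>v. u v *s v"] ub by simp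
  next
    case False
    then show ?thesis using 0 by simp
  qed
  then have "\<forall>v\<in>T - {b}. u v = 0"
    using independentD[OF assms(1) _ X] T(1) by blast
  then show "\<forall>v\<in>T. u v = 0" using ub by blast
qed

text \<open>Zorn's lemma on the independent sets between \<open>X\<close> and \<open>span Y\<close>:
  a relation is finite, so a relation in the union of a chain lives in one member, and by
  \<open>independent_insert\<close> a maximal member spans.\<close>

lemma independent_extend:
  assumes "independent X" "X \<subseteq> span Y"
  obtains Z where "X \<inter> Z = {}" "independent (X \<union> Z)" "span (X \<union> Z) = span Y"
proof -
  let ?A = "{W. X \<subseteq> W \<and> W \<subseteq> span Y \<and> independent W}"
  have "\<exists>M\<in>?A. \<forall>W\<in>?A. M \<subseteq> W \<longrightarrow> W = M"
  proof (rule subset_Zorn_nonempty)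
    show "?A \<noteq> {}" using assms by blast
    fix C assume C: "C \<noteq> {}" "subset.chain ?A C"
    have "independent (\<Union>C)"
      unfolding independent_def
    proof (intro allI impI, elim conjE)
      fix T u assume T: "finite T" "T \<subseteq> \<Union>C" "(\<Sum>v\<in>T. u v *s v) = 0"
      obtain W where "W \<in> C" "T \<subseteq> W"
        using finite_subset_Union_chain[OF T(1,2) C] by blast
      moreover have "independent W" using C(2) \<open>W \<in> C\<close> by (auto simp: subset_chain_def)
      ultimately show "\<forall>v\<in>T. u v = 0" using independentD[OF _ T(1) _ T(3)] by blast
    qed
    then show "\<Union>C \<in> ?A" using C by (auto simp: subset_chain_def)
  qed
  then obtain M where M: "X \<subseteq> M" "M \<subseteq> span Y" "independent M"
    and max: "\<And>W. X \<subseteq> W \<Longrightarrow> W \<subseteq> span Y \<Longrightarrow> independent W \<Longrightarrow> M \<subseteq> W \<Longrightarrow> W = M"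
    by (smt (verit) mem_Collect_eq)
  have "span Y \<subseteq> span M"
  proof
    fix y assume y: "y \<in> span Y"
    show "y \<in> span M"
    proof (rule ccontr)
      assume "y \<notin> span M"
      moreover from this have "insert y M = M"
        using max[of "insert y M"] independent_insert[OF M(3)] M y by blast
      ultimately show False using span_base by blast
    qed
  qed
  then have "span M = span Y" using span_span_subset[OF M(2)] by blast
  then show thesis using that[of "M - X"] M by (simp add: Un_absorb1)
qed

lemma independent_empty: "independent {}"
  by (simp add: independent_def)

lemma independent_Un:
  assumes "independent X" "independent Y" "span X \<inter> span Y \<subseteq> {0}"
  shows "independent (X \<union> Y)" and "X \<inter> Y = {}"
proof -
  show disj: "X \<inter> Y = {}"
  proof (rule ccontr)
    assume "X \<inter> Y \<noteq> {}"
    then obtain x where x: "x \<in> X" "x \<in> Y" by blast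
    then have "x = 0" using assms(3) span_base by blast
    then show False using independent_not_span[OF assms(1) x(1)] span_0 by simp
  qed
  show "independent (X \<union> Y)"
    unfolding independent_def
  proof (intro allI impI, elim conjE)
    fix T u assume T: "finite T" "T \<subseteq> X \<union> Y" "(\<Sum>v\<in>T. u v *s v) = 0"
    let ?s = "\<lambda>Z. \<Sum>v\<in>T \<inter> Z. u v *s v"
    have "T = (T \<inter> X) \<union> (T \<inter> Y)" using T by blast
    then have "(\<Sum>v\<in>T. u v *s v) = ?s X + ?s Y"
      using T(1) disj sum.union_disjoint[of "T \<inter> X" "T \<inter> Y" "\<lambda>v. u v *s v"] by auto
    then have eq: "?s X = - ?s Y" using T(3) by (simp add: eq_neg_iff_add_eq_0)
    have s: "?s Z \<in> span Z" for Z by (intro span_sum span_scale span_base) auto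
    have "?s X \<in> span Y" unfolding eq by (intro span_uminus s)
    then have X0: "?s X = 0" using assms(3) s[of X] by blast
    then have Y0: "?s Y = 0" unfolding eq by simp
    have "\<forall>v\<in>T \<inter> X. u v = 0" "\<forall>v\<in>T \<inter> Y. u v = 0"
      using independentD[OF assms(1) _ _ X0] independentD[OF assms(2) _ _ Y0] T(1) by auto
    then show "\<forall>v\<in>T. u v = 0" using T(2) by blast
  qed
qed

text \<open>Subtracting two expansions of a common vector gives a relation over
  \<open>X \<union> Y\<close>; disjointness keeps their coefficients from merging.\<close>

lemma independent_span_Int:
  assumes "independent (X \<union> Y)" "X \<inter> Y = {}"
  shows "span X \<inter> span Y \<subseteq> {0}"
proof
  fix z assume "z \<in> span X \<inter> span Y"
  then obtain T u T' u' where *: "finite T" "T \<subseteq> X" "z = (\<Sum>v\<in>T. u v *s v)"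
    "finite T'" "T' \<subseteq> Y" "z = (\<Sum>v\<in>T'. u' v *s v)"
    unfolding span_def by blast
  let ?w = "\<lambda>v. if v \<in> T then u v else - u' v"
  have "(\<Sum>v\<in>T \<union> T'. ?w v *s v) = (\<Sum>v\<in>T. ?w v *s v) + (\<Sum>v\<in>T'. ?w v *s v)"
    using *(1,2,4,5) assms(2) by (intro sum.union_disjoint) auto
  also have "(\<Sum>v\<in>T. ?w v *s v) = z" unfolding *(3) by (rule sum.cong) auto
  also have "(\<Sum>v\<in>T'. ?w v *s v) = - z"
    unfolding *(6) sum_negf[symmetric] using *(2,5) assms(2)
    by (intro sum.cong) (auto simp: scale_minus_left)
  finally have 0: "(\<Sum>v\<in>T \<union> T'. ?w v *s v) = 0" by simp
  have "u v = 0" if "v \<in> T" for v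
    using independentD[OF assms(1) _ _ 0, of v] *(1,2,4,5) that by auto
  then show "z \<in> {0}" by (simp add: *(3))
qed

section \<open>Linear maps and their extension from a basis\<close>

lemma linear_map_0: "linear_map f \<Longrightarrow> f 0 = 0"
  unfolding linear_map_def by (metis scale_zero_left)

lemma linear_map_add: "linear_map f \<Longrightarrow> f (x + y) = f x + f y"
  and linear_map_scale: "linear_map f \<Longrightarrow> f (a *s x) = a *s f x"
  by (auto simp: linear_map_def)

lemma linear_map_uminus: "linear_map f \<Longrightarrow> f (- x) = - f x"
  using linear_map_scale[of f "- 1" x] by (simp add: scale_minus_left scale_one)

lemma linear_map_diff: "linear_map f \<Longrightarrow> f (x - y) = f x - f y"
  using linear_map_add[of f x "- y"] by (simp add: linear_map_uminus)

lemma linear_map_sum: "linear_map f \<Longrightarrow> f (sum g T) = (\<Sum>x\<in>T. f (g x))"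
  by (induction T rule: infinite_finite_induct) (simp_all add: linear_map_0 linear_map_add)

lemma linear_map_id: "linear_map (\<lambda>x. x)"
  and linear_map_comp: "linear_map f \<Longrightarrow> linear_map g \<Longrightarrow> linear_map (f \<circ> g)"
  by (simp_all add: linear_map_def)

lemma linear_map_plus: "linear_map f \<Longrightarrow> linear_map g \<Longrightarrow> linear_map (\<lambda>x. f x + g x)"
  by (simp add: linear_map_def scale_right_distrib algebra_simps)

lemma subspace_vimage: "linear_map f \<Longrightarrow> subspace W \<Longrightarrow> subspace (f -` W)"
  by (simp add: subspace_def linear_map_0 linear_map_add linear_map_scale)

lemma subspace_image: "linear_map f \<Longrightarrow> subspace W \<Longrightarrow> subspace (f ` W)"
  unfolding subspace_def
  by (smt (verit, best) image_iff linear_map_0 linear_map_add linear_map_scale)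

lemma subspace_eq: "linear_map f \<Longrightarrow> linear_map g \<Longrightarrow> subspace {x. f x = g x}"
  by (simp add: subspace_def linear_map_0 linear_map_add linear_map_scale)

lemma linear_eq_on_span:
  assumes "linear_map f" "linear_map g" "\<And>x. x \<in> X \<Longrightarrow> f x = g x" "x \<in> span X"
  shows "f x = g x"
  using span_minimal[OF _ subspace_eq[OF assms(1,2)], of X] assms(3,4) by blast

lemma linear_image_span_subset:
  assumes "linear_map f" "f ` X \<subseteq> span Y"
  shows "f ` span X \<subseteq> span Y"
  using span_minimal[OF _ subspace_vimage[OF assms(1) subspace_span], of X Y] assms(2) by blast

lemma linear_span_image:
  assumes "linear_map f"
  shows "span (f ` X) = f ` span X"
proof
  show "span (f ` X) \<subseteq> f ` span X"
    by (rule span_minimal) (use span_superset in \<open>auto intro: subspace_image assms subspace_span\<close>)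
  show "f ` span X \<subseteq> span (f ` X)"
    by (rule linear_image_span_subset[OF assms span_superset])
qed

text \<open>The extension is built through its graph \<open>R\<close>. Since \<open>R\<close> is
  closed under linear combinations, single-valuedness reduces to the pairs \<open>R 0 w\<close>,
  where independence makes every coefficient zero.\<close>

lemma linear_extension:
  assumes "is_basis X"
  obtains g where "linear_map g" "\<And>x. x \<in> X \<Longrightarrow> g x = f x"
proof -
  have ind: "independent X" and sp: "span X = UNIV" using assms by (auto simp: is_basis_def)
  define R where "R v w \<longleftrightarrow> (\<exists>T u. finite T \<and> T \<subseteq> X \<and> v = (\<Sum>x\<in>T. u x *s x)
    \<and> w = (\<Sum>x\<in>T. u x *s f x))" for v w
  have add: "R (v + v') (w + w')" if vw: "R v w" "R v' w'" for v w v' w'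
  proof -
    obtain T u T' u' where *: "finite T" "T \<subseteq> X" "v = (\<Sum>v\<in>T. u v *s v)" "w = (\<Sum>v\<in>T. u v *s f v)"
      "finite T'" "T' \<subseteq> X" "v' = (\<Sum>v\<in>T'. u' v *s v)" "w' = (\<Sum>v\<in>T'. u' v *s f v)"
      using vw unfolding R_def by blast
    obtain c where c: "\<And>f :: 'v \<Rightarrow> 'v.
      (\<Sum>x\<in>T. u x *s f x) + (\<Sum>x\<in>T'. u' x *s f x) = (\<Sum>x\<in>T \<union> T'. c x *s f x)"
      using combination_add[OF *(1,5)] by blast
    from c[of f] c[of "\<lambda>x. x"] * show ?thesis
      unfolding R_def by (intro exI[of _ "T \<union> T'"] exI[of _ c]) simp
  qed
  have scl: "R (a *s v) (a *s w)" if vw: "R v w" for a v w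
  proof -
    obtain T u where *: "finite T" "T \<subseteq> X" "v = (\<Sum>v\<in>T. u v *s v)" "w = (\<Sum>v\<in>T. u v *s f v)"
      using vw unfolding R_def by blast
    then show ?thesis
      unfolding R_def
      by (intro exI[of _ T] exI[of _ "\<lambda>x. a * u x"]) (simp add: scale_sum_right scale_scale)
  qed
  have zero: "w = 0" if "R 0 w" for w
  proof -
    obtain T u where *: "finite T" "T \<subseteq> X" "0 = (\<Sum>v\<in>T. u v *s v)" "w = (\<Sum>v\<in>T. u v *s f v)"
      using \<open>R 0 w\<close> unfolding R_def by blast
    then have "\<And>v. v \<in> T \<Longrightarrow> u v = 0" using independentD[OF ind *(1,2)] by metis
    then show ?thesis using *(4) by simp
  qed
  have uniq: "w = w'" if "R v w" "R v w'" for v w w'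
  proof -
    have "R (v + (- 1) *s v) (w + (- 1) *s w')" using that add scl by blast
    then have "w + (- 1) *s w' = 0" by (intro zero) (simp add: scale_minus_left scale_one)
    then show ?thesis by (simp add: scale_minus_left scale_one)
  qed
  have "\<forall>v. \<exists>w. R v w"
  proof
    fix v have "v \<in> span X" by (simp add: sp)
    then show "\<exists>w. R v w" unfolding span_def R_def by blast
  qed
  then obtain g where g: "\<And>v. R v (g v)" by metis
  have "linear_map g"
    unfolding linear_map_def using add scl g uniq by blast
  moreover have "g x = f x" if "x \<in> X" for x
  proof -
    have "R x (f x)" unfolding R_def using that
      by (intro exI[of _ "{x}"] exI[of _ "\<lambda>_. 1"]) (simp add: scale_one)
    then show ?thesis using g uniq by blast
  qed
  ultimately show thesis using that by blast
qed

lemma scale_right_diff: "a *s (x - y) = a *s x - a *s y"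
  using scale_right_distrib[of a x "- y"] by (simp add: scale_minus_right)

lemma linear_map_minus: "linear_map f \<Longrightarrow> linear_map g \<Longrightarrow> linear_map (\<lambda>x. f x - g x)"
  by (simp add: linear_map_def scale_right_diff add_diff_add)

section \<open>The general linear group\<close>

lemma GL_iff: "f \<in> carrier GL \<longleftrightarrow> linear_map f \<and> bij f"
  by (simp add: GL_def)

lemma GL_linear: "f \<in> carrier GL \<Longrightarrow> linear_map f"
  and GL_bij: "f \<in> carrier GL \<Longrightarrow> bij f"
  by (simp_all add: GL_def)

lemma GL_comp: "f \<in> carrier GL \<Longrightarrow> g \<in> carrier GL \<Longrightarrow> f \<circ> g \<in> carrier GL"
  by (simp add: GL_iff bij_comp linear_map_comp)

lemma GL_inverse: "f \<in> carrier GL \<Longrightarrow> inverse_map f \<in> carrier GL"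
  by (simp add: GL_iff linear_map_inv bij_imp_bij_inv)

lemma GL_id: "id \<in> carrier GL"
  by (simp add: GL_iff linear_map_def)

lemma GL_inverse_left: "f \<in> carrier GL \<Longrightarrow> inverse_map f (f x) = x"
  and GL_inverse_right: "f \<in> carrier GL \<Longrightarrow> f (inverse_map f x) = x"
  by (simp_all add: GL_iff bij_is_inj bij_is_surj surj_f_inv_f)

lemma GL_inverse_inverse: "f \<in> carrier GL \<Longrightarrow> inverse_map (inverse_map f) = f"
  by (simp add: GL_iff inv_inv_eq)

lemma GL_by_inverse:
  assumes "linear_map f" "linear_map g" "f \<circ> g = id" "g \<circ> f = id"
  shows "f \<in> carrier GL" "inverse_map f = g"
  using assms o_bij inv_unique_comp by (auto simp: GL_iff)

lemma basis_exists: obtains B where "is_basis B"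
  using independent_extend[OF independent_empty, of UNIV] span_superset
  by (metis Un_empty_left empty_subsetI is_basis_def top.extremum_uniqueI)

lemma GL_eq_on_basis:
  "\<lbrakk>is_basis B; linear_map f; linear_map g; \<And>b. b \<in> B \<Longrightarrow> f b = g b\<rbrakk> \<Longrightarrow> f = g"
  using linear_eq_on_span[of f g B] by (auto simp: is_basis_def)

lemma GL_from_bij:
  assumes X: "is_basis X" and Y: "is_basis Y" and q: "bij_betw q X Y"
  obtains g where "g \<in> carrier GL" "\<And>x. x \<in> X \<Longrightarrow> g x = q x"
proof -
  obtain g where g: "linear_map g" "\<And>x. x \<in> X \<Longrightarrow> g x = q x"
    using linear_extension[OF X, of q] by blast
  obtain h where h: "linear_map h" "\<And>y. y \<in> Y \<Longrightarrow> h y = inv_into X q y"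
    using linear_extension[OF Y, of "inv_into X q"] by blast
  have "h \<circ> g = id"
    using q by (intro GL_eq_on_basis[OF X] linear_map_comp g(1) h(1))
      (auto simp: g h bij_betw_apply bij_betw_inv_into_left linear_map_def)
  moreover have "g \<circ> h = id"
    using q by (intro GL_eq_on_basis[OF Y] linear_map_comp g(1) h(1))
      (auto simp: g h bij_betw_apply[OF bij_betw_inv_into] bij_betw_inv_into_right linear_map_def)
  ultimately show thesis using that GL_by_inverse(1)[OF g(1) h(1)] g(2) by blast
qed

lemma independent_image:
  assumes f: "f \<in> carrier GL" and X: "independent X"
  shows "independent (f ` X)"
  unfolding independent_def
proof (intro allI impI, elim conjE)
  fix T u assume T: "finite T" "T \<subseteq> f ` X" and 0: "(\<Sum>v\<in>T. u v *s v) = 0"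
  let ?g = "inverse_map f"
  have inj: "inj_on ?g T"
    using GL_bij[OF GL_inverse[OF f]] by (meson bij_is_inj inj_on_subset subset_UNIV)
  have "(\<Sum>w\<in>?g ` T. u (f w) *s w) = (\<Sum>v\<in>T. u v *s ?g v)"
    by (simp add: sum.reindex[OF inj] GL_inverse_right[OF f])
  also have "\<dots> = ?g (\<Sum>v\<in>T. u v *s v)"
    by (simp add: linear_map_sum linear_map_scale GL_linear[OF GL_inverse[OF f]])
  also have "\<dots> = 0" by (simp add: 0 linear_map_0 GL_linear[OF GL_inverse[OF f]])
  finally have 1: "(\<Sum>w\<in>?g ` T. u (f w) *s w) = 0" .
  have "?g ` T \<subseteq> X" using T(2) GL_inverse_left[OF f] by auto
  then have "u (f (?g v)) = 0" if "v \<in> T" for v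
    using independentD[OF X _ _ 1] T(1) that by blast
  then show "\<forall>v\<in>T. u v = 0" by (simp add: GL_inverse_right[OF f])
qed

lemma basis_image:
  assumes "f \<in> carrier GL" "is_basis X"
  shows "is_basis (f ` X)"
  using assms independent_image[OF assms(1)] GL_bij[OF assms(1)]
  by (simp add: is_basis_def linear_span_image[OF GL_linear[OF assms(1)]] bij_is_surj)

section \<open>Exchange of bases and size of complements\<close>

lemma span_Un_cong: "span X = span X' \<Longrightarrow> span Y = span Y' \<Longrightarrow> span (X \<union> Y) = span (X' \<union> Y')"
  by (simp add: span_Un)

text \<open>Whether two blocks are in direct sum depends only on their spans, so one block of a
  basis may be replaced by any other basis of its span.\<close>

lemma independent_exchange:
  assumes "independent X" "span X = span X'" "independent (X' \<union> Y)" "X' \<inter> Y = {}"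
  shows "independent (X \<union> Y)" "X \<inter> Y = {}"
  using independent_Un[OF assms(1) independent_mono[OF assms(3)]]
    independent_span_Int[OF assms(3,4)] assms(2) by auto

lemma span_finite_subset:
  assumes "x \<in> span X"
  obtains T where "finite T" "T \<subseteq> X" "x \<in> span T"
proof -
  obtain T u where *: "finite T" "T \<subseteq> X" and x: "x = (\<Sum>v\<in>T. u v *s v)"
    using assms unfolding span_def by blast
  have "x \<in> span T" unfolding x by (intro span_sum span_scale span_base)
  then show thesis using that * by blast
qed

text \<open>Modulo \<open>span X\<close>, each element of \<open>Z\<close> involves only finitely
  many elements of \<open>Y\<close>. Together these must exhaust \<open>Y\<close>, since an omitted
  one would lie in the span of the other basis vectors. A union of finite sets over an infinite
  \<open>Z\<close> is no larger than \<open>Z\<close>.\<close>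

lemma complement_lepoll:
  assumes B: "is_basis (X \<union> Y)" and disj: "X \<inter> Y = {}" and inf: "infinite Y"
    and sp: "span (X \<union> Z) = UNIV"
  shows "Y \<lesssim> Z"
proof -
  have "\<exists>F. finite F \<and> F \<subseteq> Y \<and> z \<in> span (X \<union> F)" for z
  proof -
    have "z \<in> span (X \<union> Y)" using B by (simp add: is_basis_def)
    then obtain T where T: "finite T" "T \<subseteq> X \<union> Y" "z \<in> span T" by (rule span_finite_subset)
    have "span T \<subseteq> span (X \<union> T \<inter> Y)" by (rule span_mono) (use T in blast)
    then show ?thesis using T by (intro exI[of _ "T \<inter> Y"]) auto
  qed
  then obtain F where F: "\<And>z. finite (F z)" "\<And>z. F z \<subseteq> Y" "\<And>z. z \<in> span (X \<union> F z)" by metis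
  define Y' where "Y' = (\<Union>z\<in>Z. F z)"
  have "X \<union> Z \<subseteq> span (X \<union> Y')"
  proof
    fix z assume z: "z \<in> X \<union> Z"
    show "z \<in> span (X \<union> Y')"
    proof (cases "z \<in> X")
      case True
      then show ?thesis by (simp add: span_base)
    next
      case False
      then have "X \<union> F z \<subseteq> X \<union> Y'" using z by (auto simp: Y'_def)
      then show ?thesis using F(3) span_mono by blast
    qed
  qed
  then have U: "span (X \<union> Y') = UNIV" using span_span_subset sp by blast
  have "Y \<subseteq> Y'"
  proof
    fix y assume y: "y \<in> Y"
    show "y \<in> Y'"
    proof (rule ccontr)
      assume "y \<notin> Y'"
      then have "X \<union> Y' \<subseteq> X \<union> Y - {y}" using y disj F(2) by (auto simp: Y'_def)
      then have "y \<in> span (X \<union> Y - {y})" using span_mono U by blast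
      then show False using independent_not_span B y by (auto simp: is_basis_def)
    qed
  qed
  then have "Y \<lesssim> Y'" by (rule subset_imp_lepoll)
  \<comment> \<open>A finite \<open>Z\<close> would make \<open>Y'\<close>, hence \<open>Y\<close>,
    finite.\<close>
  moreover have "infinite Z"
    using \<open>Y \<subseteq> Y'\<close> inf F(1) finite_subset unfolding Y'_def by blast
  then have "Y' \<lesssim> Z" unfolding Y'_def using F(1) by (rule UN_finite_lepoll)
  ultimately show ?thesis by (rule lepoll_trans)
qed

text \<open>Once \<open>Y\<close> is completed to a basis by \<open>Z\<close>, both \<open>Y\<close>
  and \<open>B\<close> generate the whole space together with \<open>Z\<close>, and
  \<open>complement_lepoll\<close> compares them.\<close>

lemma independent_lepoll_basis:
  assumes "is_basis B" "infinite B" "independent Y"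
  shows "Y \<lesssim> B"
proof (cases "finite Y")
  case True
  then show ?thesis using assms(2) finite_lepoll_infinite by blast
next
  case False
  obtain Z where Z: "Y \<inter> Z = {}" "independent (Y \<union> Z)" "span (Y \<union> Z) = span UNIV"
    using independent_extend[OF assms(3), of UNIV] span_superset by blast
  then have "is_basis (Z \<union> Y)" using span_superset[of UNIV] by (auto simp: is_basis_def Un_commute)
  moreover have "span (Z \<union> B) = UNIV"
    using span_mono[of B "Z \<union> B"] assms(1) by (auto simp: is_basis_def)
  ultimately show ?thesis using complement_lepoll[of Z Y B] Z(1) False by blast
qed

lemma infinite_basis: "infinite_dimensional \<Longrightarrow> is_basis B \<Longrightarrow> infinite B"
  by (auto simp: infinite_dimensional_def)

text \<open>For a basis \<open>S \<union> R\<close> split into disjoint parts this is the subgroup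
  GL(span S) \<times> 1. The two inclusions together say that \<open>f\<close> maps
  \<open>span S\<close> onto itself.\<close>

definition block_GL :: "'v set \<Rightarrow> 'v set \<Rightarrow> ('v \<Rightarrow> 'v) set" where
  "block_GL S R = {f \<in> carrier GL. (\<forall>r\<in>R. f r = r) \<and> f ` S \<subseteq> span S \<and> inverse_map f ` S \<subseteq> span S}"

lemma block_GL_inverse: "f \<in> block_GL S R \<Longrightarrow> inverse_map f \<in> block_GL S R"
  by (auto simp: block_GL_def GL_inverse GL_inverse_inverse) (metis GL_inverse_left)

lemma block_GL_I:
  assumes h: "h \<in> carrier GL" and "\<And>r. r \<in> R \<Longrightarrow> h r = r" and img: "h ` span S = span S"
  shows "h \<in> block_GL S R"
proof -
  have "inverse_map h x \<in> span S" if "x \<in> S" for x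
  proof -
    have "x \<in> h ` span S" unfolding img using that by (rule span_base)
    then obtain y where "y \<in> span S" "x = h y" by blast
    then show ?thesis by (simp add: GL_inverse_left[OF h])
  qed
  moreover have "h x \<in> span S" if "x \<in> S" for x
    using imageI[OF span_base[OF that], of h] unfolding img .
  ultimately show ?thesis using assms(1,2) by (auto simp: block_GL_def)
qed

lemma GL_inverse_image: "f \<in> carrier GL \<Longrightarrow> inverse_map f ` (f ` X) = X"
  by (force simp: GL_inverse_left)

text \<open>A square-zero \<open>\<nu>\<close> gives (1 + \<nu>)(1 - \<nu>) = 1.\<close>

lemma transvection_GL:
  assumes "linear_map \<nu>" "\<And>x. \<nu> (\<nu> x) = 0"
  shows "(\<lambda>x. x + \<nu> x) \<in> carrier GL" "inverse_map (\<lambda>x. x + \<nu> x) = (\<lambda>x. x - \<nu> x)"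
proof -
  have l: "linear_map (\<lambda>x. x + \<nu> x)" by (intro linear_map_plus linear_map_id assms(1))
  have m: "linear_map (\<lambda>x. x - \<nu> x)" by (intro linear_map_minus linear_map_id assms(1))
  have a: "(\<lambda>x. x + \<nu> x) \<circ> (\<lambda>x. x - \<nu> x) = id" "(\<lambda>x. x - \<nu> x) \<circ> (\<lambda>x. x + \<nu> x) = id"
    by (auto simp: fun_eq_iff linear_map_add linear_map_diff assms)
  show "(\<lambda>x. x + \<nu> x) \<in> carrier GL" "inverse_map (\<lambda>x. x + \<nu> x) = (\<lambda>x. x - \<nu> x)"
    by (fact GL_by_inverse[OF l m a])+
qed

lemma linear_eq_0_on_span:
  assumes "linear_map f" "\<And>x. x \<in> X \<Longrightarrow> f x = 0" "x \<in> span X"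
  shows "f x = 0"
  using linear_eq_on_span[OF assms(1) _ _ assms(3), of "\<lambda>_. 0"] assms(2)
  by (simp add: linear_map_def)

lemma linear_range_subset_span:
  assumes "is_basis B" "linear_map f" "\<And>b. b \<in> B \<Longrightarrow> f b \<in> span Y"
  shows "f x \<in> span Y"
  using linear_image_span_subset[OF assms(2), of B Y] assms(1,3) by (auto simp: is_basis_def)

end

section \<open>Block diagonal maps and Bergman's argument\<close>

text \<open>A basis indexed by \<open>B \<times> 't\<close> splits the space into copies of itself; \<open>\<iota> t\<close> is
  the embedding onto the copy with index \<open>t\<close>. The maps \<open>monomial M \<sigma>\<close> form the wreath product
  of \<open>GL\<close> with the permutations of the indices.\<close>

locale copies = left_vector_space scale
  for scale :: "'k::division_ring \<Rightarrow> 'v::ab_group_add \<Rightarrow> 'v" (infixr "*s" 75) +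
  fixes B :: "'v set" and \<iota> :: "'t \<Rightarrow> 'v \<Rightarrow> 'v"
  assumes basis: "is_basis B"
    and linear_copy: "linear_map (\<iota> t)"
    and bij_copy: "bij_betw (\<lambda>(b, t). \<iota> t b) (B \<times> UNIV) B"
begin

lemma basis_cases:
  assumes "b \<in> B"
  obtains t c where "c \<in> B" "b = \<iota> t c"
  using assms bij_betw_imp_surj_on[OF bij_copy] by fastforce

lemma copy_in_basis: "c \<in> B \<Longrightarrow> \<iota> t c \<in> B"
  using bij_betw_apply[OF bij_copy, of "(c, t)"] by simp

lemma copies_eqI:
  assumes "linear_map f" "linear_map g" "\<And>t v. f (\<iota> t v) = g (\<iota> t v)"
  shows "f = g"
  by (rule GL_eq_on_basis[OF basis assms(1,2)]) (metis assms(3) basis_cases)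

text \<open>The universal property of the direct sum of the copies; every basis vector decodes
  uniquely to a pair of a vector in \<open>B\<close> and an index.\<close>

lemma copies_ext:
  assumes "\<And>t. linear_map (h t)"
  obtains g where "linear_map g" "\<And>t v. g (\<iota> t v) = h t v"
proof -
  let ?d = "inv_into (B \<times> UNIV) (\<lambda>(b, t). \<iota> t b)"
  have d: "?d (\<iota> t b) = (b, t)" if "b \<in> B" for b t
    using bij_betw_inv_into_left[OF bij_copy, of "(b, t)"] that by simp
  obtain g where g: "linear_map g" "\<And>x. x \<in> B \<Longrightarrow> g x = (case ?d x of (b, t) \<Rightarrow> h t b)"
    using linear_extension[OF basis, of "\<lambda>x. case ?d x of (b, t) \<Rightarrow> h t b"] by blast
  have "g \<circ> \<iota> t = h t" for t
    by (rule GL_eq_on_basis[OF basis linear_map_comp[OF g(1) linear_copy] assms])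
      (simp add: g(2) copy_in_basis d)
  then show thesis using that g(1) by (metis comp_apply)
qed

definition monomial :: "('t \<Rightarrow> 'v \<Rightarrow> 'v) \<Rightarrow> ('t \<Rightarrow> 't) \<Rightarrow> 'v \<Rightarrow> 'v" where
  "monomial M \<sigma> = (SOME g. linear_map g \<and> (\<forall>t v. g (\<iota> t v) = \<iota> (\<sigma> t) (M t v)))"

lemma monomial:
  assumes "\<And>t. linear_map (M t)"
  shows linear_monomial: "linear_map (monomial M \<sigma>)"
    and monomial_copy: "monomial M \<sigma> (\<iota> t v) = \<iota> (\<sigma> t) (M t v)"
proof -
  have "\<exists>g. linear_map g \<and> (\<forall>t v. g (\<iota> t v) = \<iota> (\<sigma> t) (M t v))"
    using copies_ext[of "\<lambda>t. \<iota> (\<sigma> t) \<circ> M t"] linear_map_comp[OF linear_copy assms]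
    by (metis comp_apply)
  from someI_ex[OF this]
  show "linear_map (monomial M \<sigma>)" "monomial M \<sigma> (\<iota> t v) = \<iota> (\<sigma> t) (M t v)"
    unfolding monomial_def by auto
qed

text \<open>Inversion in the wreath product: whatever arrives in copy \<open>t\<close> came from
  copy \<open>inverse_map \<sigma> t\<close>, so the entry of that copy has to be undone.\<close>

lemma monomial_GL:
  assumes M: "\<And>t. M t \<in> carrier GL" and \<sigma>: "bij \<sigma>"
  shows "monomial M \<sigma> \<in> carrier GL"
    and "inverse_map (monomial M \<sigma>) = monomial (\<lambda>t. inverse_map (M (inverse_map \<sigma> t))) (inverse_map \<sigma>)"
proof -
  let ?f = "monomial M \<sigma>"
  let ?g = "monomial (\<lambda>t. inverse_map (M (inverse_map \<sigma> t))) (inverse_map \<sigma>)"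
  note lin = GL_linear[OF M] GL_linear[OF GL_inverse[OF M]]
  note simps = monomial_copy lin GL_inverse_left[OF M] GL_inverse_right[OF M]
    bij_is_inj[OF \<sigma>] surj_f_inv_f[OF bij_is_surj[OF \<sigma>]]
  have f: "linear_map ?f" and g: "linear_map ?g" by (rule linear_monomial, rule lin)+
  have fg: "?f \<circ> ?g = id"
    by (rule copies_eqI) (simp_all add: linear_map_comp linear_monomial GL_linear[OF GL_id] simps)
  have gf: "?g \<circ> ?f = id"
    by (rule copies_eqI) (simp_all add: linear_map_comp linear_monomial GL_linear[OF GL_id] simps)
  show "?f \<in> carrier GL" "inverse_map ?f = ?g"
    by (fact GL_by_inverse[OF f g fg gf])+
qed

end

section \<open>Length functions and bounded block groups\<close>

locale GL_length = left_vector_space scale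
  for scale :: "'k::division_ring \<Rightarrow> 'v::ab_group_add \<Rightarrow> 'v" (infixr "*s" 75) +
  fixes len :: "('v \<Rightarrow> 'v) \<Rightarrow> nat"
  assumes len_comp: "f \<in> carrier GL \<Longrightarrow> g \<in> carrier GL \<Longrightarrow> len (f \<circ> g) \<le> len f + len g"
    and len_inverse: "f \<in> carrier GL \<Longrightarrow> len (inverse_map f) \<le> len f"
begin

definition bdd :: "('v \<Rightarrow> 'v) set \<Rightarrow> bool" where
  "bdd F \<longleftrightarrow> (\<exists>N. \<forall>f\<in>F. len f \<le> N)"

text \<open>Diagonal argument: if the blocks \<open>{n} \<times> UNIV\<close> all failed, the failures could be put together
  into one map whose length exceeds every \<open>n\<close>.\<close>

lemma diagonal:
  fixes \<iota> :: "nat \<times> 'i \<Rightarrow> 'v \<Rightarrow> 'v"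
  assumes "copies scale B \<iota>"
  shows "\<exists>n. \<forall>m. (\<forall>i. m i \<in> carrier GL) \<longrightarrow>
    (\<exists>M. (\<forall>t. M t \<in> carrier GL) \<and> (\<forall>i. M (n, i) = m i) \<and> len (copies.monomial scale \<iota> M id) \<le> n)"
proof (rule ccontr)
  interpret copies scale B \<iota> by fact
  assume "\<not> ?thesis"
  then have "\<forall>n. \<exists>m. (\<forall>i. m i \<in> carrier GL) \<and> (\<forall>M. (\<forall>t. M t \<in> carrier GL) \<and>
    (\<forall>i. M (n, i) = m i) \<longrightarrow> \<not> len (monomial M id) \<le> n)" by blast
  then obtain m where m: "\<And>n i. m n i \<in> carrier GL"
    "\<And>n M. (\<forall>t. M t \<in> carrier GL) \<and> (\<forall>i. M (n, i) = m n i) \<Longrightarrow> \<not> len (monomial M id) \<le> n"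
    by metis
  define M where "M t = m (fst t) (snd t)" for t
  \<comment> \<open>The row number doubles as the length bound, so \<open>m(2)\<close> refutes
    itself in the row whose number is the length of the assembled map.\<close>
  have "\<not> len (monomial M id) \<le> len (monomial M id)"
    by (rule m(2)) (simp add: M_def m(1))
  then show False by simp
qed

text \<open>Swindle: with \<open>a\<close> in the places \<open>(n, i)\<close>, \<open>i \<ge> 0\<close>, and the identity in the places \<open>i < 0\<close>
  of row \<open>n\<close>, the commutator with the shift of that row leaves \<open>a\<close> in place \<open>(n, 0)\<close> only. The
  uncontrolled entries outside row \<open>n\<close> cancel.\<close>

lemma single_block_bdd:
  fixes \<iota> :: "nat \<times> int \<Rightarrow> 'v \<Rightarrow> 'v"
  assumes "copies scale B \<iota>"
  shows "\<exists>n. bdd ((\<lambda>a. copies.monomial scale \<iota> (\<lambda>t. if t = (n, 0) then a else id) id) ` carrier GL)"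
proof -
  interpret copies scale B \<iota> by fact
  obtain n where n: "\<And>m. (\<forall>i. m i \<in> carrier GL) \<Longrightarrow>
    \<exists>M. (\<forall>t. M t \<in> carrier GL) \<and> (\<forall>i. M (n, i) = m i) \<and> len (monomial M id) \<le> n"
    using diagonal[OF assms] by blast
  define \<sigma> :: "nat \<times> int \<Rightarrow> nat \<times> int" where "\<sigma> = (\<lambda>(k, i). (k, if k = n then i + 1 else i))"
  define \<tau> :: "nat \<times> int \<Rightarrow> nat \<times> int" where "\<tau> = (\<lambda>(k, i). (k, if k = n then i - 1 else i))"
  have "\<sigma> \<circ> \<tau> = id" "\<tau> \<circ> \<sigma> = id" by (auto simp: \<sigma>_def \<tau>_def)
  then have \<sigma>: "bij \<sigma>" "inverse_map \<sigma> = \<tau>" by (auto intro: o_bij inv_unique_comp)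
  define s where "s = monomial (\<lambda>_. id) \<sigma>"
  have s: "s \<in> carrier GL" "inverse_map s = monomial (\<lambda>_. id) \<tau>"
    using monomial_GL[of "\<lambda>_. id" \<sigma>] GL_id \<sigma> by (simp_all add: s_def)
  \<comment> \<open>The commutator contains the controlled map and its inverse, each of length at
    most \<open>n\<close>, and \<open>s\<close> and its inverse; \<open>s\<close> depends on
    \<open>n\<close> but not on \<open>a\<close>.\<close>
  have "len (monomial (\<lambda>t. if t = (n, 0) then a else id) id) \<le> 2 * n + 2 * len s"
    if a: "a \<in> carrier GL" for a
  proof -
    obtain M where M: "\<And>t. M t \<in> carrier GL" and row: "\<And>i. M (n, i) = (if i \<ge> 0 then a else id)"
      and len: "len (monomial M id) \<le> n"
      using n[of "\<lambda>i. if i \<ge> 0 then a else id"] a GL_id by (metis (no_types, lifting))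
    let ?x = "monomial M id"
    note x = monomial_GL[OF M bij_id, simplified inv_id id_apply]
    note lin = GL_linear[OF M] GL_linear[OF GL_inverse[OF M]] GL_linear[OF GL_id] GL_linear[OF a]
    have eq: "monomial (\<lambda>t. if t = (n, 0) then a else id) id = ?x \<circ> (s \<circ> (inverse_map ?x \<circ> inverse_map s))"
    proof (rule copies_eqI)
      show "linear_map (monomial (\<lambda>t. if t = (n, 0) then a else id) id)"
        using lin by (intro linear_monomial) auto
      show "linear_map (?x \<circ> (s \<circ> (inverse_map ?x \<circ> inverse_map s)))"
        by (intro GL_linear GL_comp GL_inverse x(1) s(1))
      fix t v
      have L: "monomial (\<lambda>t. if t = (n, 0) then a else id) id (\<iota> t v)
          = \<iota> t ((if t = (n, 0) then a else id) v)"
        using lin by (subst monomial_copy) auto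
      have R: "(?x \<circ> (s \<circ> (inverse_map ?x \<circ> inverse_map s))) (\<iota> t v)
          = \<iota> (\<sigma> (\<tau> t)) (M (\<sigma> (\<tau> t)) (inverse_map (M (\<tau> t)) v))"
        unfolding x(2) s(2) unfolding s_def by (simp add: monomial_copy lin)
      have "\<sigma> (\<tau> t) = t" using \<open>\<sigma> \<circ> \<tau> = id\<close> by (metis comp_apply id_apply)
      moreover obtain k i where t: "t = (k, i)" by (cases t)
      \<comment> \<open>In row \<open>n\<close> this compares neighbouring places: \<open>a\<close>
        against the identity at \<open>i = 0\<close>, \<open>a\<close> against \<open>a\<close> for
        \<open>i > 0\<close>, identities for \<open>i < 0\<close>. In the other rows
        \<open>\<tau> t = t\<close>.\<close>
      have "M t (inverse_map (M (\<tau> t)) v) = (if t = (n, 0) then a else id) v"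
      proof (cases "k = n")
        case True
        then show ?thesis using a by (auto simp: t \<tau>_def row GL_inverse_right inv_id)
      next
        case False
        then show ?thesis by (auto simp: t \<tau>_def GL_inverse_right[OF M])
      qed
      ultimately show "monomial (\<lambda>t. if t = (n, 0) then a else id) id (\<iota> t v)
          = (?x \<circ> (s \<circ> (inverse_map ?x \<circ> inverse_map s))) (\<iota> t v)"
        using L R by simp
    qed
    have "len (?x \<circ> (s \<circ> (inverse_map ?x \<circ> inverse_map s))) \<le> len ?x + (len s + (len ?x + len s))"
      by (intro order_trans[OF len_comp] add_mono le_refl len_inverse GL_comp GL_inverse x(1) s(1))
    also have "\<dots> \<le> 2 * n + 2 * len s" using len by simp
    finally show ?thesis unfolding eq .
  qed
  then show ?thesis unfolding bdd_def by blast
qed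

lemma bddI: "(\<And>f. f \<in> F \<Longrightarrow> len f \<le> N) \<Longrightarrow> bdd F"
  by (auto simp: bdd_def)

lemma bdd_subset: "bdd G \<Longrightarrow> F \<subseteq> G \<Longrightarrow> bdd F"
  by (auto simp: bdd_def)

text \<open>Translates \<open>single_block_bdd\<close> from copies to bases: \<open>P\<close> is the
  part of \<open>B\<close> in copy \<open>(n, 0)\<close>, and each element of its block group is a
  monomial map with one free entry. Another whole copy in the complement makes that as large as
  \<open>B\<close>.\<close>

lemma some_block_bdd:
  assumes B: "is_basis B" "infinite B"
  obtains P where "P \<subseteq> B" "P \<approx> B" "B - P \<approx> B" "bdd (block_GL P (B - P))"
proof -
  obtain e where e: "bij_betw e (B \<times> (UNIV :: (nat \<times> int) set)) B"
    using times_countable_eqpoll[OF B(2), of "UNIV :: (nat \<times> int) set"] by (auto simp: eqpoll_def)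
  have "\<exists>g. linear_map g \<and> (\<forall>b\<in>B. g b = e (b, t))" for t
    by (rule linear_extension[OF B(1), of "\<lambda>b. e (b, t)"]) auto
  then obtain \<iota> where \<iota>: "\<And>t. linear_map (\<iota> t)" "\<And>t b. b \<in> B \<Longrightarrow> \<iota> t b = e (b, t)" by metis
  have "bij_betw (\<lambda>(b, t). \<iota> t b) (B \<times> UNIV) B"
    using e by (subst bij_betw_cong[of _ _ e]) (auto simp: \<iota>(2))
  then interpret copies scale B \<iota>
    by unfold_locales (auto intro: B \<iota>(1))
  obtain n where n: "bdd ((\<lambda>a. monomial (\<lambda>t. if t = (n, 0) then a else id) id) ` carrier GL)"
    using single_block_bdd[OF copies_axioms] by blast
  let ?t = "(n, 0)"
  define P where "P = \<iota> ?t ` B"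
  have inj: "\<iota> t b = \<iota> t' b' \<longleftrightarrow> b = b' \<and> t = t'" if "b \<in> B" "b' \<in> B" for t t' b b'
    using inj_onD[OF bij_betw_imp_inj_on[OF bij_copy], of "(b, t)" "(b', t')"] that by auto
  have eq: "\<iota> t ` B \<approx> B" for t
    by (rule inj_on_image_eqpoll_self) (auto simp: inj_on_def inj)
  have P: "P \<subseteq> B" "P \<approx> B" by (auto simp: P_def copy_in_basis eq)
  have "\<iota> (n, 1) ` B \<subseteq> B - P" by (auto simp: P_def inj copy_in_basis)
  then have P': "B - P \<approx> B" by (rule infinite_eqpoll_between[OF B(2) eq _ subset_imp_lepoll]) blast
  \<comment> \<open>\<open>\<rho>\<close> will be the retraction onto copy \<open>(n, 0)\<close>,
    zero on the others; it reads off the entry \<open>a\<close> of a block map.\<close>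
  have "linear_map (if t = ?t then id else (\<lambda>_. 0))" for t
    by (simp add: linear_map_def)
  from copies_ext[of "\<lambda>t. if t = ?t then id else (\<lambda>_. 0)", OF this]
  obtain \<rho> where \<rho>: "linear_map \<rho>" "\<And>t v. \<rho> (\<iota> t v) = (if t = ?t then id else (\<lambda>_. 0)) v"
    by metis
  have span_P: "span P = range (\<iota> ?t)"
    using B(1) by (simp add: P_def linear_span_image[OF \<iota>(1)] is_basis_def)
  have "block_GL P (B - P) \<subseteq> (\<lambda>a. monomial (\<lambda>t. if t = ?t then a else id) id) ` carrier GL"
  proof
    fix g assume g: "g \<in> block_GL P (B - P)"
    then have gGL: "g \<in> carrier GL" by (simp add: block_GL_def)
    \<comment> \<open>\<open>f\<close> keeps the copy \<open>span P\<close> invariant, and there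
      embedding after retraction is the identity.\<close>
    have ret: "\<iota> ?t (\<rho> (f (\<iota> ?t v))) = f (\<iota> ?t v)" if f: "f \<in> block_GL P (B - P)" for f v
    proof -
      have "f ` span P \<subseteq> span P"
        using f by (intro linear_image_span_subset) (auto simp: block_GL_def GL_linear)
      then obtain w where "f (\<iota> ?t v) = \<iota> ?t w" unfolding span_P by blast
      then show ?thesis by (simp add: \<rho>(2))
    qed
    define a where "a = \<rho> \<circ> g \<circ> \<iota> ?t"
    define a' where "a' = \<rho> \<circ> inverse_map g \<circ> \<iota> ?t"
    have lin: "linear_map a" "linear_map a'"
      unfolding a_def a'_def
      by (intro linear_map_comp \<rho>(1) \<iota>(1) GL_linear[OF gGL] GL_linear[OF GL_inverse[OF gGL]])+
    have "a \<circ> a' = id" "a' \<circ> a = id"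
      by (auto simp: fun_eq_iff a_def a'_def ret[OF g] ret[OF block_GL_inverse[OF g]]
        GL_inverse_left[OF gGL] GL_inverse_right[OF gGL] \<rho>(2))
    then have a: "a \<in> carrier GL" using GL_by_inverse(1)[OF lin] by blast
    have "g = monomial (\<lambda>t. if t = ?t then a else id) id"
    proof (rule copies_eqI)
      show "linear_map g" by (rule GL_linear[OF gGL])
      have linM: "linear_map (if t = ?t then a else id)" for t
        using lin(1) GL_linear[OF GL_id] by simp
      show "linear_map (monomial (\<lambda>t. if t = ?t then a else id) id)"
        by (rule linear_monomial[OF linM])
      fix t v
      have "g (\<iota> t v) = \<iota> t ((if t = ?t then a else id) v)"
      proof (cases "t = ?t")
        case True
        then show ?thesis by (simp add: a_def ret[OF g])
      next
        case False
        have "g \<circ> \<iota> t = \<iota> t"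
        proof (rule GL_eq_on_basis[OF B(1) linear_map_comp[OF GL_linear[OF gGL] \<iota>(1)] \<iota>(1)])
          fix b assume "b \<in> B"
          then have "\<iota> t b \<in> B - P" using False by (auto simp: P_def inj copy_in_basis)
          then show "(g \<circ> \<iota> t) b = \<iota> t b" using g by (simp add: block_GL_def)
        qed
        then show ?thesis using False by (metis comp_apply id_apply)
      qed
      then show "g (\<iota> t v) = monomial (\<lambda>t. if t = ?t then a else id) id (\<iota> t v)"
        by (simp only: monomial_copy[OF linM] id_apply)
    qed
    then show "g \<in> (\<lambda>a. monomial (\<lambda>t. if t = ?t then a else id) id) ` carrier GL"
      using a by blast
  qed
  then show thesis using that P P' bdd_subset[OF n] by blast
qed

text \<open>Any two splittings of the basis into two parts of full size are conjugate under some
  \<open>p\<close> in \<open>GL\<close>. As \<open>p\<close> does not depend on \<open>g\<close>,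
  conjugation costs only the constant \<open>2 * len p\<close>.\<close>

lemma block_bdd:
  assumes B: "is_basis (S \<union> R)" and inf: "infinite S" and disj: "S \<inter> R = {}" and RS: "R \<approx> S"
  shows "bdd (block_GL S R)"
proof -
  have infB: "infinite (S \<union> R)" using inf by simp
  obtain P where P: "P \<subseteq> S \<union> R" "P \<approx> S \<union> R" "S \<union> R - P \<approx> S \<union> R"
    and bd: "bdd (block_GL P (S \<union> R - P))"
    using some_block_bdd[OF B infB] by blast
  let ?Q = "S \<union> R - P"
  have "S \<union> R \<lesssim> S" using infinite_Un_lepoll[OF inf lepoll_refl eqpoll_imp_lepoll[OF RS]] .
  then have S: "S \<approx> S \<union> R" by (meson Un_upper1 lepoll_antisym subset_imp_lepoll)
  then have R: "R \<approx> S \<union> R" using RS eqpoll_trans by blast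
  obtain q where q: "bij_betw q S P" "bij_betw q R ?Q" "bij_betw q (S \<union> R) (P \<union> ?Q)"
    using bij_betw_Un_obtain[of S P R ?Q] S R P disj by (metis Diff_disjoint eqpoll_sym eqpoll_trans)
  have PQ: "P \<union> ?Q = S \<union> R" using P(1) by blast
  obtain p where p: "p \<in> carrier GL" "\<And>x. x \<in> S \<union> R \<Longrightarrow> p x = q x"
    using GL_from_bij[OF B B, of q] q(3) PQ by auto
  have img: "p ` S = P" "p ` R = ?Q"
    using image_cong[OF refl p(2), of S] image_cong[OF refl p(2), of R]
      bij_betw_imp_surj_on[OF q(1)] bij_betw_imp_surj_on[OF q(2)] by simp_all
  have inv_img: "inverse_map p ` P = S"
    unfolding img(1)[symmetric] by (force simp: GL_inverse_left[OF p(1)])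
  have spans: "p ` span S = span P" "inverse_map p ` span P = span S"
    by (simp_all add: linear_span_image[symmetric] GL_linear p(1) GL_inverse img inv_img)
  obtain N where N: "\<And>f. f \<in> block_GL P ?Q \<Longrightarrow> len f \<le> N" using bd by (auto simp: bdd_def)
  show ?thesis
  proof (rule bddI[where N = "len p + (N + len p)"])
    fix g assume g: "g \<in> block_GL S R"
    then have gGL: "g \<in> carrier GL" by (simp add: block_GL_def)
    let ?h = "p \<circ> (g \<circ> inverse_map p)"
    have hGL: "?h \<in> carrier GL" by (intro GL_comp GL_inverse p(1) gGL)
    have inv_h: "inverse_map ?h = p \<circ> (inverse_map g \<circ> inverse_map p)"
      by (rule inv_unique_comp)
        (auto simp: fun_eq_iff GL_inverse_left GL_inverse_right p(1) gGL)
    have conj: "(p \<circ> (f \<circ> inverse_map p)) ` P \<subseteq> span P" if "f ` S \<subseteq> span S" for f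
    proof -
      have "(p \<circ> (f \<circ> inverse_map p)) ` P = p ` f ` S" by (metis image_comp inv_img)
      then show ?thesis using that spans(1) by blast
    qed
    have "?h \<in> block_GL P ?Q"
      unfolding block_GL_def
    proof (intro CollectI conjI ballI)
      fix r assume "r \<in> ?Q"
      then obtain x where "x \<in> R" "r = p x" using img(2) by blast
      then show "?h r = r" using g by (simp add: block_GL_def GL_inverse_left[OF p(1)])
    next
      show "?h ` P \<subseteq> span P" using g by (intro conj) (simp add: block_GL_def)
      show "inverse_map ?h ` P \<subseteq> span P"
        unfolding inv_h using g by (intro conj) (simp add: block_GL_def)
    qed (rule hGL)
    then have h: "len ?h \<le> N" by (rule N)
    have g_eq: "g = inverse_map p \<circ> (?h \<circ> p)"
      by (auto simp: fun_eq_iff GL_inverse_left[OF p(1)])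
    have "len (inverse_map p \<circ> (?h \<circ> p)) \<le> len p + (len ?h + len p)"
      by (intro order_trans[OF len_comp] add_mono le_refl len_inverse GL_comp GL_inverse hGL p(1))
    then have "len g \<le> len p + (len ?h + len p)" by (simp only: g_eq[symmetric])
    then show "len g \<le> len p + (N + len p)" using h by linarith
  qed
qed

end

section \<open>Factorisation into block maps\<close>

text \<open>Three equally large parts, so that each of the blocks \<open>C\<close>,
  \<open>A \<union> C1\<close> and \<open>A \<union> C2\<close> leaves a full-size part of the basis
  fixed, as \<open>block_bdd\<close> demands.\<close>

locale decomposed_GL_length = GL_length scale len
  for scale :: "'k::division_ring \<Rightarrow> 'v::ab_group_add \<Rightarrow> 'v" (infixr "*s" 75) and len +
  fixes A C1 C2 :: "'v set"
  assumes basis: "is_basis (A \<union> C1 \<union> C2)"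
    and disjoint: "A \<inter> C1 = {}" "A \<inter> C2 = {}" "C1 \<inter> C2 = {}"
    and infinite_A: "infinite A"
    and eqpoll: "C1 \<approx> A" "C2 \<approx> A"
begin

abbreviation "C \<equiv> C1 \<union> C2"

lemma basis_AC: "is_basis (A \<union> C)"
  using basis by (simp add: Un_assoc)

lemma disjoint_AC: "A \<inter> C = {}"
  using disjoint by blast

lemma eqpoll_C: "C \<approx> A"
  by (rule infinite_eqpoll_between[OF infinite_A eqpoll(1)])
    (use infinite_Un_lepoll[OF infinite_A] eqpoll eqpoll_imp_lepoll in blast)+

lemma independent_A: "independent A"
  using basis_AC independent_mono by (auto simp: is_basis_def)

lemma bdd_C: "bdd (block_GL C A)"
  using block_bdd[of C A] basis_AC disjoint_AC eqpoll_C infinite_A eqpoll_finite_iff[OF eqpoll_C]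
  by (simp add: Un_commute Int_commute eqpoll_sym del: finite_Un)

lemma bdd_AC1: "bdd (block_GL (A \<union> C1) C2)" and bdd_AC2: "bdd (block_GL (A \<union> C2) C1)"
proof -
  have *: "D \<approx> A \<Longrightarrow> E \<approx> A \<Longrightarrow> D \<approx> A \<union> E" for D E
    by (meson Un_least Un_upper1 infinite_Un_lepoll infinite_A eqpoll_imp_lepoll eqpoll_sym
      eqpoll_trans infinite_eqpoll_between lepoll_refl eqpoll_refl)
  have "A \<union> C2 \<union> C1 = A \<union> C1 \<union> C2" by blast
  then show "bdd (block_GL (A \<union> C1) C2)" "bdd (block_GL (A \<union> C2) C1)"
    using basis infinite_A disjoint eqpoll * by (auto intro!: block_bdd)
qed

section \<open>Transvections and maps fixing \<open>A\<close>\<close>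

lemma linear_ext_AC:
  obtains g where "linear_map g" "\<And>x. x \<in> A \<Longrightarrow> g x = f x" "\<And>x. x \<in> C \<Longrightarrow> g x = f' x"
proof -
  obtain g where "linear_map g" "\<And>x. x \<in> A \<union> C \<Longrightarrow> g x = (if x \<in> A then f x else f' x)"
    by (rule linear_extension[OF basis_AC, of "\<lambda>x. if x \<in> A then f x else f' x"]) (rule that)
  then show thesis using that disjoint_AC by (metis UnI1 UnI2 disjoint_iff)
qed

text \<open>Block matrices for \<open>span A\<close> and \<open>span C\<close> whose only possibly
  nonzero block goes from \<open>span C\<close> to \<open>span A\<close>. The composite of any two
  is zero.\<close>

definition strictly_upper :: "('v \<Rightarrow> 'v) \<Rightarrow> bool" where
  "strictly_upper \<nu> \<longleftrightarrow> linear_map \<nu> \<and> (\<forall>a\<in>A. \<nu> a = 0) \<and> (\<forall>x. \<nu> x \<in> span A)"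

lemma strictly_upper_span: "strictly_upper \<nu> \<Longrightarrow> x \<in> span A \<Longrightarrow> \<nu> x = 0"
  using linear_eq_0_on_span by (auto simp: strictly_upper_def)

lemma strictly_upper_GL:
  assumes "strictly_upper \<nu>"
  shows "(\<lambda>x. x + \<nu> x) \<in> carrier GL" "inverse_map (\<lambda>x. x + \<nu> x) = (\<lambda>x. x - \<nu> x)"
proof -
  have "linear_map \<nu>" "\<And>x. \<nu> (\<nu> x) = 0"
    using assms strictly_upper_span[OF assms] by (auto simp: strictly_upper_def)
  then show "(\<lambda>x. x + \<nu> x) \<in> carrier GL" "inverse_map (\<lambda>x. x + \<nu> x) = (\<lambda>x. x - \<nu> x)"
    by (fact transvection_GL)+
qed

lemma strictly_upper_block:
  assumes \<nu>: "strictly_upper \<nu>" and E: "\<And>x. x \<in> R \<Longrightarrow> \<nu> x = 0"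
  shows "(\<lambda>x. x + \<nu> x) \<in> block_GL (A \<union> S) R"
proof -
  have "span A \<subseteq> span (A \<union> S)" by (rule span_mono) simp
  then have "\<nu> x \<in> span (A \<union> S)" for x using \<nu> by (auto simp: strictly_upper_def)
  then have "x + \<nu> x \<in> span (A \<union> S)" "x - \<nu> x \<in> span (A \<union> S)" if "x \<in> A \<union> S" for x
    using span_add span_diff span_base[OF that] by blast+
  then show ?thesis
    using E by (simp add: block_GL_def strictly_upper_GL[OF \<nu>] image_subset_iff)
qed

text \<open>Restricting \<open>\<nu>\<close> to the two halves of \<open>C\<close> gives
  \<open>\<nu> = \<mu>1 + \<mu>2\<close>. As \<mu>1 \<mu>2 = 0, the map factors as (1 + \<mu>1)(1 +
  \<mu>2), and each factor fixes the half of \<open>C\<close> that the other one may move.\<close>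

lemma transvection_bdd: "bdd ((\<lambda>\<nu> x. x + \<nu> x) ` Collect strictly_upper)"
proof -
  obtain N1 N2 where N: "\<And>f. f \<in> block_GL (A \<union> C1) C2 \<Longrightarrow> len f \<le> N1"
    "\<And>f. f \<in> block_GL (A \<union> C2) C1 \<Longrightarrow> len f \<le> N2"
    using bdd_AC1 bdd_AC2 by (auto simp: bdd_def)
  have "len (\<lambda>x. x + \<nu> x) \<le> N1 + N2" if \<nu>: "strictly_upper \<nu>" for \<nu>
  proof -
    have ext: "\<exists>\<mu>. strictly_upper \<mu> \<and> (\<forall>x\<in>C. \<mu> x = (if x \<in> S then \<nu> x else 0))" for S
    proof -
      obtain g where g: "linear_map g" "\<And>x. x \<in> A \<Longrightarrow> g x = 0"
        "\<And>x. x \<in> C \<Longrightarrow> g x = (if x \<in> S then \<nu> x else 0)"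
        by (rule linear_ext_AC[of "\<lambda>_. 0" "\<lambda>x. if x \<in> S then \<nu> x else 0"]) (rule that)
      have "g x \<in> span A" for x
        using \<nu> by - (rule linear_range_subset_span[OF basis_AC g(1)],
          auto simp: g span_0 strictly_upper_def)
      then show ?thesis using g by (auto simp: strictly_upper_def)
    qed
    obtain \<mu>1 where \<mu>1: "strictly_upper \<mu>1" "\<And>x. x \<in> C \<Longrightarrow> \<mu>1 x = (if x \<in> C1 then \<nu> x else 0)"
      using ext by blast
    obtain \<mu>2 where \<mu>2: "strictly_upper \<mu>2" "\<And>x. x \<in> C \<Longrightarrow> \<mu>2 x = (if x \<in> C2 then \<nu> x else 0)"
      using ext by blast
    have b1: "(\<lambda>x. x + \<mu>1 x) \<in> block_GL (A \<union> C1) C2"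
      by (rule strictly_upper_block[OF \<mu>1(1)]) (use \<mu>1(2) disjoint in auto)
    have b2: "(\<lambda>x. x + \<mu>2 x) \<in> block_GL (A \<union> C2) C1"
      by (rule strictly_upper_block[OF \<mu>2(1)]) (use \<mu>2(2) disjoint in auto)
    have "\<mu>1 (\<mu>2 x) = 0" for x
      using strictly_upper_span[OF \<mu>1(1)] \<mu>2(1) by (simp add: strictly_upper_def)
    moreover have "\<nu> = (\<lambda>x. \<mu>2 x + \<mu>1 x)"
    proof (rule GL_eq_on_basis[OF basis_AC])
      show "linear_map \<nu>" using \<nu> by (simp add: strictly_upper_def)
      show "linear_map (\<lambda>x. \<mu>2 x + \<mu>1 x)"
        using \<mu>1(1) \<mu>2(1) by (intro linear_map_plus) (simp_all add: strictly_upper_def)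
      fix b assume "b \<in> A \<union> C"
      then show "\<nu> b = \<mu>2 b + \<mu>1 b"
        using \<mu>1 \<mu>2 \<nu> disjoint by (auto simp: strictly_upper_def)
    qed
    ultimately have "(\<lambda>x. x + \<nu> x) = (\<lambda>x. x + \<mu>1 x) \<circ> (\<lambda>x. x + \<mu>2 x)"
      using \<mu>1(1) by (auto simp: fun_eq_iff strictly_upper_def linear_map_add add.assoc)
    then have "len (\<lambda>x. x + \<nu> x) \<le> len (\<lambda>x. x + \<mu>1 x) + len (\<lambda>x. x + \<mu>2 x)"
      using len_comp[OF strictly_upper_GL(1)[OF \<mu>1(1)] strictly_upper_GL(1)[OF \<mu>2(1)]] by simp
    then show ?thesis using N(1)[OF b1] N(2)[OF b2] by linarith
  qed
  then show ?thesis by (intro bddI[where N = "N1 + N2"]) auto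
qed

lemma projection:
  obtains \<pi> where "linear_map \<pi>" "\<And>x. x \<in> span A \<Longrightarrow> \<pi> x = 0" "\<And>x. x \<in> span C \<Longrightarrow> \<pi> x = x"
    "\<And>x. \<pi> x \<in> span C" "\<And>x. x - \<pi> x \<in> span A"
proof -
  obtain \<pi> where \<pi>: "linear_map \<pi>" "\<And>x. x \<in> A \<Longrightarrow> \<pi> x = 0" "\<And>x. x \<in> C \<Longrightarrow> \<pi> x = x"
    by (rule linear_ext_AC[of "\<lambda>_. 0" "\<lambda>x. x"]) (rule that)
  have A: "\<pi> x = 0" if "x \<in> span A" for x using linear_eq_0_on_span \<pi>(1,2) that by blast
  have C: "\<pi> x = x" if "x \<in> span C" for x
    using linear_eq_on_span[OF \<pi>(1) linear_map_id \<pi>(3) that] .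
  have "\<pi> x \<in> span C \<and> x - \<pi> x \<in> span A" for x
  proof -
    have "x \<in> span (A \<union> C)" using basis_AC by (simp add: is_basis_def)
    then obtain y z where "x = y + z" "y \<in> span A" "z \<in> span C" by (auto simp: span_Un)
    then show ?thesis using A C by (simp add: linear_map_add[OF \<pi>(1)])
  qed
  then show thesis using that \<pi>(1) A C by blast
qed

text \<open>Such a map is upper triangular with respect to \<open>span A \<oplus> span C\<close>.\<close>

lemma fixing_A_bdd: "bdd {F \<in> carrier GL. \<forall>a\<in>A. F a = a}"
proof -
  obtain \<pi> where \<pi>: "linear_map \<pi>" "\<And>x. x \<in> span A \<Longrightarrow> \<pi> x = 0"
    "\<And>x. x \<in> span C \<Longrightarrow> \<pi> x = x" "\<And>x. \<pi> x \<in> span C" "\<And>x. x - \<pi> x \<in> span A"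
    using projection by blast
  obtain N1 N2 where N1: "\<And>\<nu>. strictly_upper \<nu> \<Longrightarrow> len (\<lambda>x. x + \<nu> x) \<le> N1"
    and N2: "\<And>f. f \<in> block_GL C A \<Longrightarrow> len f \<le> N2"
    using transvection_bdd bdd_C by (auto simp: bdd_def)
  have "len F \<le> N1 + N2" if F: "F \<in> carrier GL" and fixed: "\<And>a. a \<in> A \<Longrightarrow> F a = a" for F
  proof -
    let ?G = "inverse_map F"
    have linF: "linear_map F" and linG: "linear_map ?G" using F by (auto intro: GL_linear GL_inverse)
    have FA: "F x = x" if "x \<in> span A" for x
      using linear_eq_on_span[OF linF linear_map_id fixed that] .
    have GA: "?G x = x" if "x \<in> span A" for x
      using FA[OF that] GL_inverse_left[OF F, of x] by simp
    \<comment> \<open>For \<open>F\<close> with block rows (1, b) and (0, d) this is \<nu> = b d^-1: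
      on \<open>span C\<close>, \<open>\<pi>\<close> after \<open>?G\<close> is d^-1, and
      subtracting \<open>\<pi>\<close> keeps the \<open>span A\<close> part of the image under
      \<open>F\<close>. Then \<open>F'\<close> is diagonal with entries 1 and d.\<close>
    define \<nu> where "\<nu> x = F (\<pi> (?G x)) - \<pi> (F (\<pi> (?G x)))" for x
    have \<nu>: "strictly_upper \<nu>"
      unfolding strictly_upper_def
    proof (intro conjI ballI allI)
      have "linear_map (F \<circ> (\<pi> \<circ> ?G))" by (intro linear_map_comp linF linG \<pi>(1))
      from linear_map_minus[OF this linear_map_comp[OF \<pi>(1) this]]
      show "linear_map \<nu>" by (simp add: \<nu>_def[abs_def] comp_def)
      fix a assume "a \<in> A"
      then have "\<pi> (?G a) = 0" using GA \<pi>(2) span_base by simp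
      then show "\<nu> a = 0" by (simp add: \<nu>_def linear_map_0 linF \<pi>(1))
    next
      fix x show "\<nu> x \<in> span A" unfolding \<nu>_def by (rule \<pi>(5))
    qed
    let ?u = "\<lambda>x. x + \<nu> x"
    note u = strictly_upper_GL[OF \<nu>]
    define F' where "F' = inverse_map ?u \<circ> F"
    have F': "F' x = F x - \<nu> (F x)" for x by (simp add: F'_def u(2))
    have F'GL: "F' \<in> carrier GL" unfolding F'_def by (intro GL_comp GL_inverse u(1) F)
    have F'A: "F' x = x" if "x \<in> span A" for x
      using that strictly_upper_span[OF \<nu> that] by (simp add: F' FA)
    \<comment> \<open>On \<open>span C\<close> the formula collapses to
      \<open>F' x = \<pi> (F x)\<close>.\<close>
    have F'C: "F' x \<in> span C" if "x \<in> span C" for x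
      using \<pi>(3)[OF that] \<pi>(4) by (simp add: F' \<nu>_def GL_inverse_left[OF F])
    have "inverse_map F' x \<in> span C" if x: "x \<in> span C" for x
    proof -
      let ?y = "inverse_map F' x"
      \<comment> \<open>\<open>?y - \<pi> ?y\<close> lies in \<open>span A\<close>, so
        \<open>F'\<close> fixes it. It is therefore equal to an element of \<open>span C\<close> and
        must vanish.\<close>
      have "F' (?y - \<pi> ?y) = x - F' (\<pi> ?y)"
        by (simp add: linear_map_diff[OF GL_linear[OF F'GL]] GL_inverse_right[OF F'GL])
      also have "\<dots> \<in> span C" using x F'C \<pi>(4) by (intro span_diff) auto
      finally have "?y - \<pi> ?y \<in> span C" using F'A \<pi>(5) by simp
      then have "\<pi> (?y - \<pi> ?y) = ?y - \<pi> ?y" by (rule \<pi>(3))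
      then have "?y = \<pi> ?y" using \<pi>(2)[OF \<pi>(5)] by simp
      then show ?thesis using \<pi>(4) by metis
    qed
    then have "F' \<in> block_GL C A"
      using F'GL F'A F'C by (auto simp: block_GL_def span_base)
    then have "len F' \<le> N2" by (rule N2)
    moreover have "F = ?u \<circ> F'"
      using GL_inverse_right[OF u(1)] by (simp add: F'_def fun_eq_iff)
    then have "len F \<le> len ?u + len F'" using len_comp[OF u(1) F'GL] by metis
    ultimately show ?thesis using N1[OF \<nu>] by linarith
  qed
  then show ?thesis by (intro bddI[where N = "N1 + N2"]) auto
qed

text \<open>The transvection straightens the subspace \<open>D\<close> into the sum of its intersection with
  \<open>span A\<close> and its projection to \<open>span C\<close>.\<close>

lemma subspace_normal_form:
  assumes D: "subspace D"
  obtains \<nu> K0 K1 L0 L1 where "strictly_upper \<nu>"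
    "K0 \<inter> K1 = {}" "independent (K0 \<union> K1)" "span (K0 \<union> K1) = span A"
    "L0 \<inter> L1 = {}" "independent (L0 \<union> L1)" "span (L0 \<union> L1) = span C"
    "(\<lambda>x. x + \<nu> x) ` span (K0 \<union> L0) = D"
proof -
  obtain \<pi> where \<pi>: "linear_map \<pi>" "\<And>x. x \<in> span A \<Longrightarrow> \<pi> x = 0"
    "\<And>x. x \<in> span C \<Longrightarrow> \<pi> x = x" "\<And>x. \<pi> x \<in> span C" "\<And>x. x - \<pi> x \<in> span A"
    using projection by blast
  have basis_of: "\<exists>K0 K1. K0 \<inter> K1 = {} \<and> independent (K0 \<union> K1) \<and> span (K0 \<union> K1) = span X \<and> span K0 = W"
    if W: "subspace W" "W \<subseteq> span X" for W X
  proof -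
    obtain K0 where K0: "independent K0" "span K0 = W"
      using independent_extend[OF independent_empty, of W] span_subspace[OF W(1)] by auto
    then have "K0 \<subseteq> span X" using W(2) span_superset by blast
    then show ?thesis using independent_extend[OF K0(1), of X] K0(2) by metis
  qed
  \<comment> \<open>\<open>D\<close> is an extension of its projection by its part in
    \<open>span A\<close>; \<open>K0\<close> and \<open>L0\<close> are bases of these two
    pieces.\<close>
  have "subspace (D \<inter> span A)" using D subspace_span[of A] by (auto simp: subspace_def)
  then obtain K0 K1 where K: "K0 \<inter> K1 = {}" "independent (K0 \<union> K1)" "span (K0 \<union> K1) = span A"
    "span K0 = D \<inter> span A" using basis_of[of "D \<inter> span A" A] by blast
  obtain L0 L1 where L: "L0 \<inter> L1 = {}" "independent (L0 \<union> L1)" "span (L0 \<union> L1) = span C"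
    "span L0 = \<pi> ` D" using basis_of[OF subspace_image[OF \<pi>(1) D], of C] \<pi>(4) by blast
  have "\<exists>y. y \<in> D \<and> \<pi> y = l" if "l \<in> L0" for l
    using that span_base[of l L0] L(4) by auto
  then obtain d where d: "\<And>l. l \<in> L0 \<Longrightarrow> d l \<in> D" "\<And>l. l \<in> L0 \<Longrightarrow> \<pi> (d l) = l" by metis
  have AL: "is_basis ((L0 \<union> L1) \<union> A)" "(L0 \<union> L1) \<inter> A = {}"
    using independent_exchange[OF L(2,3), of A] basis_AC disjoint_AC span_Un_cong[OF L(3), of A A]
    by (auto simp: is_basis_def Un_commute Int_commute)
  \<comment> \<open>\<open>d l - l\<close> is the error in \<open>span A\<close> by which the lift
    \<open>d l\<close> of \<open>l\<close> misses \<open>l\<close>, so that \<open>1 + \<nu>\<close>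
    takes \<open>l\<close> to \<open>d l\<close>.\<close>
  obtain \<nu> where lin: "linear_map \<nu>" and \<nu>_val:
    "\<And>x. x \<in> (L0 \<union> L1) \<union> A \<Longrightarrow> \<nu> x = (if x \<in> L0 then d x - x else 0)"
    by (rule linear_extension[OF AL(1), of "\<lambda>x. if x \<in> L0 then d x - x else 0"]) (rule that)
  have "d l - l \<in> span A" if "l \<in> L0" for l using \<pi>(5)[of "d l"] d(2)[OF that] by simp
  then have "\<nu> x \<in> span A" for x
    by - (rule linear_range_subset_span[OF AL(1) lin], simp add: \<nu>_val span_0)
  then have \<nu>: "strictly_upper \<nu>"
    using lin \<nu>_val AL(2) by (auto simp: strictly_upper_def)
  let ?u = "\<lambda>x. x + \<nu> x"
  have linu: "linear_map ?u" using strictly_upper_GL(1)[OF \<nu>] GL_linear by blast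
  have K0A: "K0 \<subseteq> span A" using K(4) span_superset by blast
  have sub: "?u ` span (K0 \<union> L0) \<subseteq> D"
  proof -
    have "?u x \<in> D" if "x \<in> K0 \<union> L0" for x
    proof (cases "x \<in> L0")
      case True
      then show ?thesis using d(1) \<nu>_val by simp
    next
      case False
      then have "x \<in> K0" using that by blast
      then show ?thesis using strictly_upper_span[OF \<nu>] K0A K(4) span_base[of x K0] by auto
    qed
    then have "?u ` (K0 \<union> L0) \<subseteq> D" by blast
    from span_minimal[OF this D] show ?thesis
      unfolding linear_span_image[OF linu, of "K0 \<union> L0"] .
  qed
  have "D \<subseteq> ?u ` span (K0 \<union> L0)"
  proof
    fix x assume x: "x \<in> D"
    have "\<pi> x \<in> span L0" using x L(4) by simp
    then have px: "\<pi> x \<in> span (K0 \<union> L0)" using span_mono[of L0 "K0 \<union> L0"] by blast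
    have "?u (\<pi> x) \<in> D" using sub px by blast
    then have xd: "x - ?u (\<pi> x) \<in> D" using subspace_diff[OF D x] by blast
    \<comment> \<open>Subtracting the lift of its projection leaves a vector of both
      \<open>D\<close> and \<open>span A\<close>, hence of \<open>span K0\<close>, on which
      \<open>1 + \<nu>\<close> is the identity.\<close>
    have "x - ?u (\<pi> x) = (x - \<pi> x) - \<nu> (\<pi> x)" by (simp add: algebra_simps)
    also have "\<dots> \<in> span A" using \<nu> by (intro span_diff[OF \<pi>(5)]) (simp add: strictly_upper_def)
    finally have xA: "x - ?u (\<pi> x) \<in> span A" .
    then have "x - ?u (\<pi> x) \<in> span K0" using xd K(4) by blast
    then have "x - ?u (\<pi> x) \<in> span (K0 \<union> L0)" using span_mono[of K0 "K0 \<union> L0"] by blast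
    then have mem: "(x - ?u (\<pi> x)) + \<pi> x \<in> span (K0 \<union> L0)" using px by (rule span_add)
    have "\<nu> ((x - ?u (\<pi> x)) + \<pi> x) = \<nu> (\<pi> x)"
      unfolding linear_map_add[OF lin] strictly_upper_span[OF \<nu> xA] by simp
    then have "x = ?u ((x - ?u (\<pi> x)) + \<pi> x)" by simp
    then show "x \<in> ?u ` span (K0 \<union> L0)" using mem by (rule image_eqI)
  qed
  with sub have "?u ` span (K0 \<union> L0) = D" by (rule subset_antisym)
  then show thesis by (rule that[OF \<nu> K(1-3) L(1-3)])
qed

section \<open>Moving a straightened subspace onto \<open>span A\<close>\<close>

lemma span_AC: "span (A \<union> C) = UNIV"
  using basis_AC by (simp add: is_basis_def)

lemma basis_exchange_C:
  assumes "independent L" "span L = span C"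
  shows "is_basis (A \<union> L)" "A \<inter> L = {}"
  using independent_exchange[OF assms, of A] basis_AC disjoint_AC span_Un_cong[OF refl assms(2), of A]
  by (auto simp: is_basis_def Un_commute Int_commute)

lemma independent_lepoll_A:
  assumes "independent Y"
  shows "Y \<lesssim> A"
proof -
  have "A \<union> C \<lesssim> A"
    by (rule infinite_Un_lepoll[OF infinite_A lepoll_refl eqpoll_imp_lepoll[OF eqpoll_C]])
  moreover have "Y \<lesssim> A \<union> C"
    by (rule independent_lepoll_basis[OF basis_AC _ assms]) (simp add: infinite_A)
  ultimately show ?thesis using lepoll_trans by blast
qed

text \<open>Choose \<open>g\<close> fixing \<open>A\<close> and taking \<open>L0 \<union> L'\<close>
  to \<open>C1\<close> and \<open>L''\<close> to \<open>C2\<close>. Choose \<open>k\<close> undoing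
  \<open>E\<close> on the image of \<open>A\<close>, taking \<open>K1 \<union> L'\<close> to
  \<open>C1\<close> and agreeing with \<open>g\<close> on \<open>L''\<close>. Then h = k g^-1 fixes
  \<open>C2\<close> pointwise and preserves \<open>span (A \<union> C1)\<close>, while
  \<open>h \<circ> g = k\<close> returns each \<open>E a\<close> to \<open>a\<close>.\<close>

lemma straighten:
  assumes E: "E \<in> carrier GL" and EA: "E ` span A = span (K0 \<union> L0)"
    and K: "K0 \<inter> K1 = {}" "independent (K0 \<union> K1)" "span (K0 \<union> K1) = span A"
    and L: "L0 \<inter> L1 = {}" "independent (L0 \<union> L1)" "span (L0 \<union> L1) = span C"
    and L1: "A \<lesssim> L1"
  obtains g h where "g \<in> block_GL C A" "h \<in> block_GL (A \<union> C1) C2" "\<And>a. a \<in> A \<Longrightarrow> h (g (E a)) = a"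
proof -
  have indep_eqpoll: "Y \<approx> A" if "independent Y" "Z \<subseteq> Y" "Z \<approx> A" for Y Z
    by (rule infinite_eqpoll_between[OF infinite_A that(3,2) independent_lepoll_A[OF that(1)]])
  have "infinite L1" using L1 infinite_A by (meson infinite_le_lepoll lepoll_trans)
  \<comment> \<open>Nothing is known about the sizes of \<open>L0\<close> and \<open>K1\<close>: the
    half \<open>L'\<close> pads both to full size, and \<open>L''\<close> is kept for
    \<open>C2\<close>.\<close>
  then obtain L' L'' where split: "L' \<union> L'' = L1" "L' \<inter> L'' = {}" "L' \<approx> L1" "L'' \<approx> L1"
    by (rule infinite_split)
  have "L1 \<approx> A"
    using L1 independent_lepoll_A[OF independent_mono[OF L(2)], of L1] by (simp add: lepoll_antisym)
  then have L': "L' \<approx> A" "L'' \<approx> A" using split eqpoll_trans by blast+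
  have LA: "is_basis (A \<union> (L0 \<union> L1))" "A \<inter> (L0 \<union> L1) = {}" by (rule basis_exchange_C[OF L(2,3)])+
  have L0L': "L0 \<union> L' \<approx> A"
    by (rule indep_eqpoll[OF independent_mono[OF L(2)] _ L'(1)]) (use split in auto)
  have L_eq: "(L0 \<union> L') \<union> L'' = L0 \<union> L1" "(L0 \<union> L') \<inter> L'' = {}" using split L(1) by blast+
  obtain q where q: "bij_betw q (L0 \<union> L') C1" "bij_betw q L'' C2" "bij_betw q (L0 \<union> L1) C"
    using bij_betw_Un_obtain[of "L0 \<union> L'" C1 L'' C2] L0L' L'(2) eqpoll disjoint(3) L_eq
    by (metis eqpoll_sym eqpoll_trans)
  have bij_g: "bij_betw (\<lambda>x. if x \<in> A then x else q x) (A \<union> (L0 \<union> L1)) (A \<union> C)"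
    using LA(2) disjoint_AC by (intro bij_betw_disjoint_Un q(3)) (auto simp: bij_betw_def)
  obtain g where g: "g \<in> carrier GL"
    and g_val: "\<And>x. x \<in> A \<union> (L0 \<union> L1) \<Longrightarrow> g x = (if x \<in> A then x else q x)"
    by (rule GL_from_bij[OF LA(1) basis_AC bij_g]) (rule that)
  have gA: "g a = a" if "a \<in> A" for a using g_val that by simp
  have gq: "g x = q x" if "x \<in> L0 \<union> L1" for x using g_val LA(2) that by auto
  have g_cong: "g ` Z = q ` Z" if "Z \<subseteq> L0 \<union> L1" for Z
    using that gq by (intro image_cong) auto
  have g_img: "g ` (L0 \<union> L1) = C" "g ` (L0 \<union> L') = C1" "g ` L'' = C2"
    using g_cong[OF subset_refl] g_cong[of "L0 \<union> L'", OF Un_upper1[of "L0 \<union> L'" L'', unfolded L_eq(1)]]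
      g_cong[of L'', OF Un_upper2[of L'' "L0 \<union> L'", unfolded L_eq(1)]]
    by (simp_all only: q[THEN bij_betw_imp_surj_on])
  have "g ` span C = span C"
    using linear_span_image[OF GL_linear[OF g], of "L0 \<union> L1"] g_img(1) L(3) by simp
  then have gC: "g \<in> block_GL C A" using g gA by (intro block_GL_I)

  have spanEA: "span (E ` A) = span (K0 \<union> L0)"
    using linear_span_image[OF GL_linear[OF E]] EA by simp
  have KL: "is_basis ((K0 \<union> K1) \<union> (L0 \<union> L1))" "(K0 \<union> K1) \<inter> (L0 \<union> L1) = {}"
    using independent_exchange[OF K(2,3), of "L0 \<union> L1"] LA span_Un_cong[OF K(3) refl, of "L0 \<union> L1"]
    by (auto simp: is_basis_def)
  have KL_eq: "(K0 \<union> K1) \<union> (L0 \<union> L1) = (K0 \<union> L0) \<union> (K1 \<union> L1)" by blast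
  have KL_disj: "(K0 \<union> L0) \<inter> (K1 \<union> L1) = {}" using K(1) L(1) KL(2) by blast
  have J: "is_basis (E ` A \<union> (K1 \<union> L1))" "E ` A \<inter> (K1 \<union> L1) = {}"
    using independent_exchange[OF independent_image[OF E independent_A] spanEA, of "K1 \<union> L1"]
      KL(1) KL_disj span_Un_cong[OF spanEA refl, of "K1 \<union> L1"]
    by (auto simp: is_basis_def KL_eq)
  have J_eq: "(K1 \<union> L') \<union> L'' = K1 \<union> L1" "(K1 \<union> L') \<inter> L'' = {}"
    using split KL(2) by blast+
  have "K1 \<union> L' \<approx> A"
  proof (rule indep_eqpoll[OF _ _ L'(1)])
    show "independent (K1 \<union> L')"
      using KL(1) split(1) by (auto simp: is_basis_def intro: independent_mono)
  qed simp
  then obtain r where r: "bij_betw r (K1 \<union> L') C1"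
    using eqpoll(1) by (meson eqpoll_def eqpoll_sym eqpoll_trans)
  have invE: "bij_betw (inverse_map E) (E ` A) A"
    by (rule bij_betw_imageI)
      (auto simp: GL_inverse_image[OF E] inj_on_def GL_inverse_left[OF E])
  \<comment> \<open>Any bijection \<open>r\<close> will do on the middle part; only
    \<open>inverse_map E\<close> and \<open>q\<close> are forced.\<close>
  define k0 where "k0 x = (if x \<in> E ` A then inverse_map E x else if x \<in> K1 \<union> L' then r x else q x)" for x
  have "bij_betw k0 (E ` A \<union> ((K1 \<union> L') \<union> L'')) (A \<union> C)"
    unfolding k0_def using J(2) J_eq disjoint disjoint_AC
    by (intro bij_betw_disjoint_Un invE r q(2)) auto
  then have bij_k: "bij_betw k0 (E ` A \<union> (K1 \<union> L1)) (A \<union> C)" by (simp only: J_eq(1))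
  obtain k where k: "k \<in> carrier GL" and k_val: "\<And>x. x \<in> E ` A \<union> (K1 \<union> L1) \<Longrightarrow> k x = k0 x"
    by (rule GL_from_bij[OF J(1) basis_AC bij_k]) (rule that)
  have kE: "k (E a) = a" if "a \<in> A" for a
    using k_val[of "E a"] that by (simp add: k0_def GL_inverse_left[OF E])
  have kr: "k x = r x" if "x \<in> K1 \<union> L'" for x
  proof -
    have "x \<in> K1 \<union> L1" "x \<notin> E ` A" using that J(2) J_eq(1) by blast+
    then show ?thesis using k_val[of x] that by (simp add: k0_def)
  qed
  have kq: "k x = q x" if "x \<in> L''" for x
  proof -
    have "x \<in> K1 \<union> L1" "x \<notin> E ` A" "x \<notin> K1 \<union> L'" using that J(2) J_eq by blast+
    then show ?thesis using k_val[of x] by (simp add: k0_def)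
  qed
  have "k ` (E ` A) = A" using kE by (force simp: image_image)
  moreover have "k ` (K1 \<union> L') = C1"
    using image_cong[OF refl kr, of "K1 \<union> L'"] r by (simp add: bij_betw_def)
  ultimately have k_img: "k ` (E ` A \<union> (K1 \<union> L')) = A \<union> C1" by (simp add: image_Un)
  \<comment> \<open>The same \<open>W\<close> is described by two bases, one adapted to
    \<open>k\<close> and one to \<open>g\<close>. Both maps send it to
    \<open>span (A \<union> C1)\<close>, hence \<open>h\<close> preserves that span.\<close>
  let ?W = "span (E ` A \<union> (K1 \<union> L'))"
  have kW: "k ` ?W = span (A \<union> C1)"
    using linear_span_image[OF GL_linear[OF k], of "E ` A \<union> (K1 \<union> L')"] k_img by simp
  have "?W = span ((K0 \<union> L0) \<union> (K1 \<union> L'))" by (rule span_Un_cong[OF spanEA refl])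
  also have "(K0 \<union> L0) \<union> (K1 \<union> L') = (K0 \<union> K1) \<union> (L0 \<union> L')" by blast
  also have "span \<dots> = span (A \<union> (L0 \<union> L'))" by (rule span_Un_cong[OF K(3) refl])
  finally have W: "?W = span (A \<union> (L0 \<union> L'))" .
  have "g ` (A \<union> (L0 \<union> L')) = A \<union> C1"
    using gA g_img(2) by (simp add: image_Un)
  then have gW: "g ` ?W = span (A \<union> C1)"
    unfolding W using linear_span_image[OF GL_linear[OF g], of "A \<union> (L0 \<union> L')"] by simp
  define h where "h = k \<circ> inverse_map g"
  have "h \<in> block_GL (A \<union> C1) C2"
  proof (rule block_GL_I)
    show "h \<in> carrier GL" unfolding h_def by (intro GL_comp GL_inverse k g)
    show "h c = c" if "c \<in> C2" for c
    proof -
      have "c \<in> g ` L''" unfolding g_img(3) by (fact that)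
      then obtain x where x: "x \<in> L''" "c = g x" by blast
      then show ?thesis using gq[of x] kq[of x] split(1) by (auto simp: h_def GL_inverse_left[OF g])
    qed
    show "h ` span (A \<union> C1) = span (A \<union> C1)"
      unfolding h_def image_comp[symmetric] using GL_inverse_image[OF g, of ?W] gW kW by simp
  qed
  moreover have "h (g (E a)) = a" if "a \<in> A" for a
    using kE[OF that] by (simp add: h_def GL_inverse_left[OF g])
  ultimately show thesis using that[OF gC] by blast
qed

lemma len_bounded: "bdd (carrier GL)"
proof -
  obtain N1 where N1: "\<And>\<nu>. strictly_upper \<nu> \<Longrightarrow> len (\<lambda>x. x + \<nu> x) \<le> N1"
    using transvection_bdd by (auto simp: bdd_def)
  obtain N2 where N2: "\<And>f. f \<in> block_GL C A \<Longrightarrow> len f \<le> N2"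
    using bdd_C by (auto simp: bdd_def)
  obtain N3 where N3: "\<And>f. f \<in> block_GL (A \<union> C1) C2 \<Longrightarrow> len f \<le> N3"
    using bdd_AC1 by (auto simp: bdd_def)
  obtain N4 where N4: "\<And>f. f \<in> carrier GL \<Longrightarrow> \<forall>a\<in>A. f a = a \<Longrightarrow> len f \<le> N4"
    using fixing_A_bdd by (auto simp: bdd_def)
  \<comment> \<open>\<open>E\<close> is recovered as g^-1 h^-1 (h g E), whose last factor fixes
    \<open>A\<close> pointwise.\<close>
  have straight: "len E \<le> N2 + (N3 + N4)"
    if E: "E \<in> carrier GL" and "E ` span A = span (K0 \<union> L0)"
      "K0 \<inter> K1 = {}" "independent (K0 \<union> K1)" "span (K0 \<union> K1) = span A"
      "L0 \<inter> L1 = {}" "independent (L0 \<union> L1)" "span (L0 \<union> L1) = span C" "A \<lesssim> L1"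
    for E K0 K1 L0 L1
  proof -
    note asm = that
    obtain g h where g: "g \<in> block_GL C A" and h: "h \<in> block_GL (A \<union> C1) C2"
      and fixed: "\<And>a. a \<in> A \<Longrightarrow> h (g (E a)) = a"
      by (rule straighten[OF asm]) (rule that)
    have GL: "g \<in> carrier GL" "h \<in> carrier GL" using g h by (auto simp: block_GL_def)
    let ?F = "h \<circ> (g \<circ> E)"
    have F: "?F \<in> carrier GL" by (intro GL_comp GL E)
    have "len (inverse_map g \<circ> (inverse_map h \<circ> ?F)) \<le> len g + (len h + len ?F)"
      by (intro order_trans[OF len_comp] add_mono le_refl len_inverse GL_comp GL_inverse GL F)
    moreover have "inverse_map g \<circ> (inverse_map h \<circ> ?F) = E"
      by (auto simp: fun_eq_iff GL_inverse_left GL)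
    ultimately have "len E \<le> len g + (len h + len ?F)" by simp
    then show ?thesis using N2[OF g] N3[OF h] N4[OF F] fixed by fastforce
  qed
  obtain q where q: "bij_betw q A C" "bij_betw q C A" "bij_betw q (A \<union> C) (C \<union> A)"
    using bij_betw_Un_obtain[OF eqpoll_sym[OF eqpoll_C] eqpoll_C disjoint_AC] disjoint_AC
    by (metis Int_commute)
  obtain \<sigma> where \<sigma>: "\<sigma> \<in> carrier GL" "\<And>x. x \<in> A \<union> C \<Longrightarrow> \<sigma> x = q x"
    using GL_from_bij[OF basis_AC basis_AC, of q] q(3) by (metis Un_commute)
  have "\<sigma> ` A = C" "\<sigma> ` C = A"
    using image_cong[OF refl \<sigma>(2), of A] image_cong[OF refl \<sigma>(2), of C] q by (auto simp: bij_betw_def)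
  then have \<sigma>_span: "\<sigma> ` span A = span C" "\<sigma> ` span C = span A"
    by (simp_all add: linear_span_image[OF GL_linear[OF \<sigma>(1)], symmetric])
  have "len f \<le> N1 + (len \<sigma> + (N2 + (N3 + N4)))" if f: "f \<in> carrier GL" for f
  proof -
    obtain \<nu> K0 K1 L0 L1 where \<nu>: "strictly_upper \<nu>"
      and K: "K0 \<inter> K1 = {}" "independent (K0 \<union> K1)" "span (K0 \<union> K1) = span A"
      and L: "L0 \<inter> L1 = {}" "independent (L0 \<union> L1)" "span (L0 \<union> L1) = span C"
      and D: "(\<lambda>x. x + \<nu> x) ` span (K0 \<union> L0) = f ` span A"
      by (rule subspace_normal_form[OF subspace_image[OF GL_linear[OF f] subspace_span[of A]]])
    let ?u = "\<lambda>x. x + \<nu> x"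
    have u: "?u \<in> carrier GL" by (rule strictly_upper_GL(1)[OF \<nu>])
    define E where "E = inverse_map ?u \<circ> f"
    have E: "E \<in> carrier GL" unfolding E_def by (intro GL_comp GL_inverse u f)
    have EA: "E ` span A = span (K0 \<union> L0)"
      unfolding E_def image_comp[symmetric] D[symmetric] by (rule GL_inverse_image[OF u])
    \<comment> \<open>The image of \<open>C\<close> under \<open>E\<close> and
      \<open>K1 \<union> L1\<close> both span complements of the image of \<open>span A\<close>, and
      the former has the size of \<open>A\<close>.\<close>
    have "A \<lesssim> K1 \<union> L1"
    proof -
      have inj: "inj E" using GL_bij[OF E] by (rule bij_is_inj)
      have EC: "E ` C \<approx> A"
        using inj_on_image_eqpoll_self[of E C] eqpoll_C eqpoll_trans inj by (metis inj_on_subset subset_UNIV)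
      have "E ` C \<lesssim> K1 \<union> L1"
      proof (rule complement_lepoll)
        show "is_basis (E ` A \<union> E ` C)" using basis_image[OF E basis_AC] by (simp add: image_Un)
        show "E ` A \<inter> E ` C = {}" using disjoint_AC image_Int[OF inj] by (metis image_empty)
        show "infinite (E ` C)" using eqpoll_finite_iff[OF EC] infinite_A by blast
        have "span (E ` A) = span (K0 \<union> L0)"
          using linear_span_image[OF GL_linear[OF E]] EA by simp
        then have "span (E ` A \<union> (K1 \<union> L1)) = span ((K0 \<union> L0) \<union> (K1 \<union> L1))"
          by (rule span_Un_cong[OF _ refl])
        also have "(K0 \<union> L0) \<union> (K1 \<union> L1) = (K0 \<union> K1) \<union> (L0 \<union> L1)" by blast
        also have "span \<dots> = span (A \<union> C)" by (rule span_Un_cong[OF K(3) L(3)])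
        finally show "span (E ` A \<union> (K1 \<union> L1)) = UNIV" using span_AC by simp
      qed
      then show ?thesis using EC by (meson eqpoll_sym lepoll_trans1)
    qed
    then consider "A \<lesssim> L1" | "A \<lesssim> K1" using infinite_lepoll_Un[OF infinite_A] by blast
    then have "len E \<le> len \<sigma> + (N2 + (N3 + N4))"
    proof cases
      case 1
      then show ?thesis using straight[OF E EA K L] by simp
    next
      case 2
      have \<sigma>E: "\<sigma> \<circ> E \<in> carrier GL" by (intro GL_comp \<sigma>(1) E)
      have inj: "inj \<sigma>" using GL_bij[OF \<sigma>(1)] by (rule bij_is_inj)
      note lin = linear_span_image[OF GL_linear[OF \<sigma>(1)]]
      \<comment> \<open>After \<open>\<sigma>\<close> the roles of the K's and L's are exchanged:
        the image of the large \<open>K1\<close> now lies in \<open>span C\<close>.\<close>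
      have "len (\<sigma> \<circ> E) \<le> N2 + (N3 + N4)"
      proof (rule straight[OF \<sigma>E])
        show "(\<sigma> \<circ> E) ` span A = span (\<sigma> ` L0 \<union> \<sigma> ` K0)"
          unfolding image_comp[symmetric] EA by (simp add: image_Un[symmetric] lin Un_commute)
        show "\<sigma> ` L0 \<inter> \<sigma> ` L1 = {}" "\<sigma> ` K0 \<inter> \<sigma> ` K1 = {}"
          using K(1) L(1) by (simp_all add: image_Int[OF inj, symmetric])
        show "independent (\<sigma> ` L0 \<union> \<sigma> ` L1)" "independent (\<sigma> ` K0 \<union> \<sigma> ` K1)"
          using independent_image[OF \<sigma>(1)] K(2) L(2) by (simp_all add: image_Un[symmetric])
        show "span (\<sigma> ` L0 \<union> \<sigma> ` L1) = span A" "span (\<sigma> ` K0 \<union> \<sigma> ` K1) = span C"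
          using K(3) L(3) by (simp_all add: image_Un[symmetric] lin \<sigma>_span)
        have "\<sigma> ` K1 \<approx> K1"
          using inj by (intro inj_on_image_eqpoll_self) (meson inj_on_subset subset_UNIV)
        then show "A \<lesssim> \<sigma> ` K1" using 2 by (meson eqpoll_sym lepoll_trans2)
      qed
      moreover have "len (inverse_map \<sigma> \<circ> (\<sigma> \<circ> E)) \<le> len \<sigma> + len (\<sigma> \<circ> E)"
        by (intro order_trans[OF len_comp] add_mono le_refl len_inverse GL_inverse \<sigma>(1) \<sigma>E)
      moreover have "inverse_map \<sigma> \<circ> (\<sigma> \<circ> E) = E"
        by (auto simp: fun_eq_iff GL_inverse_left \<sigma>(1))
      ultimately show ?thesis by simp
    qed
    moreover have "f = ?u \<circ> E" by (simp add: E_def fun_eq_iff GL_inverse_right[OF u])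
    then have "len f \<le> len ?u + len E" using len_comp[OF u E] by metis
    ultimately show ?thesis using N1[OF \<nu>] by linarith
  qed
  then show ?thesis by (rule bddI)
qed

end

theorem (in GL_length) GL_length_bounded:
  assumes "infinite_dimensional"
  shows "bdd (carrier GL)"
proof -
  obtain B where B: "is_basis B" by (rule basis_exists)
  have inf: "infinite B" using assms B by (rule infinite_basis)
  obtain A C where AC: "A \<union> C = B" "A \<inter> C = {}" "A \<approx> B" "C \<approx> B" using inf by (rule infinite_split)
  have "infinite A" "infinite C" using AC inf eqpoll_finite_iff by blast+
  then obtain C1 C2 where C: "C1 \<union> C2 = C" "C1 \<inter> C2 = {}" "C1 \<approx> C" "C2 \<approx> C"
    using infinite_split by metis
  have "C \<approx> A" using AC by (meson eqpoll_sym eqpoll_trans)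
  then interpret decomposed_GL_length scale len A C1 C2
    using AC C B \<open>infinite A\<close> by unfold_locales (auto simp: Un_assoc intro: eqpoll_trans)
  show ?thesis by (rule len_bounded)
qed

theorem theorem2p1:
  fixes scale :: "'k::division_ring \<Rightarrow> 'v::ab_group_add \<Rightarrow> 'v"
    and X :: "('v \<Rightarrow> 'v) set"
  assumes "left_vector_space scale"
    and "left_vector_space.infinite_dimensional scale"
    and "generating_set (left_vector_space.GL scale) X"
  shows "wid (left_vector_space.GL scale) X \<noteq> \<infinity>"
proof -
  interpret left_vector_space scale by fact
  interpret group GL by (rule group_GL)
  have inv: "m_inv GL f = inverse_map f" if "f \<in> carrier GL" for f
    by (rule inv_equality) (use that GL_inverse[OF that] in \<open>auto simp: GL_def bij_is_inj\<close>)
  have mult: "f \<otimes>\<^bsub>GL\<^esub> g = f \<circ> g" for f g by (simp add: GL_def)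
  interpret GL_length scale "word_length GL X"
    using word_length_mult[OF assms(3)] word_length_inv[OF assms(3)]
    by unfold_locales (simp_all add: mult inv)
  obtain N where "\<And>f. f \<in> carrier GL \<Longrightarrow> word_length GL X f \<le> N"
    using GL_length_bounded[OF assms(2)] by (auto simp: bdd_def)
  then have "wid GL X \<le> enat N" unfolding wid_def by (intro SUP_least) simp
  then show ?thesis by (metis infinity_ileE)
qed

end
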